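(* Let $(w_0,\ldots,w_n)$ and $(v_0,\ldots,v_m)$ be positive integer weights, let $\ell\ge1$, and let $p(x_1,\ldots,x_n)$ and $q(y_1,\ldots,y_m)$ be quasi-smooth weighted homogeneous polynomials of degrees $\ell w_0$ and $\ell v_0$ respectively. Put $$V_1=\{x_0^\ell+p(x_1,\ldots,x_n)=0\}\subset\mathbf{P}_{(w_0,w_1,\ldots,w_n)},\qquad V_2=\{y_0^\ell+q(y_1,\ldots,y_m)=0\}\subset\mathbf{P}_{(v_0,v_1,\ldots,v_m)},$$ $$X=\{p(z_1,\ldots,z_n)-q(t_1,\ldots,t_m)=0\}\subset\mathbf{P}_{(v_0w_1,\ldots,v_0w_n,w_0v_1,\ldots,w_0v_m)}.$$ Then the rational map $$\Phi:\mathbf{P}_{(w_0,\ldots,w_n)}\times\mathbf{P}_{(v_0,\ldots,v_m)}\dashrightarrow\mathbf{P}_{(v_0w_1,\ldots,v_0w_n,w_0v_1,\ldots,w_0v_m)},$$ $$((x_0,\ldots,x_n),(y_0,\ldots,y_m))\mapsto\bigl(y_0^{w_1/w_0}x_1,\ldots,y_0^{w_n/w_0}x_n,\,x_0^{v_1/v_0}y_1,\ldots,x_0^{v_m/v_0}y_m\bigr)$$ restricts to $V_1\times V_2$ to give a rational generically finite map onto $X$.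
   Context: All varieties are over $\mathbf{C}$. $\mathbf{P}_{(w_0,\ldots,w_n)}$ is the weighted projective space, the quotient of $\mathbf{C}^{n+1}\setminus\{0\}$ by $\mathbf{C}^*$ acting by $t\cdot(z_0,\ldots,z_n)=(t^{w_0}z_0,\ldots,t^{w_n}z_n)$. The weights $(w_0,\ldots,w_n)$ and $(v_0,\ldots,v_m)$ are assumed normalized: no $n$ of the $n+1$ weights $w_i$ (respectively no $m$ of the $m+1$ weights $v_j$) have a common divisor $>1$. A weighted homogeneous polynomial is quasi-smooth if its affine zero set (the cone) is smooth outside the origin. In $\Phi$, the fractional powers are formed from a $w_0$-th root $y_0^{1/w_0}$ of $y_0$ and a $v_0$-th root $x_0^{1/v_0}$ of $x_0$, with $y_0^{w_i/w_0}=(y_0^{1/w_0})^{w_i}$ and $x_0^{v_j/v_0}=(x_0^{1/v_0})^{v_j}$.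
   Formalization: Φ is multivalued when gcd(w_0,v_0)>1 (e.g. w=v=(2,1,1), l=2), so it is an ordinary rational map only if w_0, v_0 are coprime; otherwise it is shown to be finite-valued and rational after adjoining the roots of x_0 and y_0. In all cases it is dominant onto X and generically finite. *)

theory Defs
  imports "HOL-Analysis.Analysis" "HOL-Library.Poly_Mapping"
begin

text \<open>
  Complex polynomials in variables indexed by a finite type, as finitely supported families of
  coefficients indexed by exponent vectors.
\<close>

type_synonym 'i cpoly = "('i \<Rightarrow>\<^sub>0 nat) \<Rightarrow>\<^sub>0 complex"

definition peval :: "'i::finite cpoly \<Rightarrow> ('i \<Rightarrow> complex) \<Rightarrow> complex" where
  "peval f x = (\<Sum>m\<in>Poly_Mapping.keys f.
     Poly_Mapping.lookup f m * (\<Prod>i\<in>UNIV. x i ^ Poly_Mapping.lookup m i))"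

definition whomog :: "('i::finite \<Rightarrow> nat) \<Rightarrow> nat \<Rightarrow> 'i cpoly \<Rightarrow> bool" where
  "whomog w d f \<longleftrightarrow>
     (\<forall>m\<in>Poly_Mapping.keys f. (\<Sum>i\<in>UNIV. w i * Poly_Mapping.lookup m i) = d)"

text \<open>
  Smoothness of the affine hypersurface \<open>f = 0\<close> is the Jacobian criterion for the equation \<open>f\<close>;
  in particular \<open>f = 0\<close> identically is excluded.
\<close>

definition quasi_smooth :: "'i::finite cpoly \<Rightarrow> bool" where
  "quasi_smooth f \<longleftrightarrow>
     (\<forall>x. x \<noteq> (\<lambda>_. 0) \<and> peval f x = 0 \<longrightarrow> (\<exists>i. deriv (\<lambda>t. peval f (x(i := t))) (x i) \<noteq> 0))"

definition normalized_weights :: "('i \<Rightarrow> nat) \<Rightarrow> bool" where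
  "normalized_weights w \<longleftrightarrow> (\<forall>k d. (\<forall>i. i \<noteq> k \<longrightarrow> d dvd w i) \<longrightarrow> d = 1)"


text \<open>
  A space whose points have (multi-)homogeneous coordinates: \<open>coords P\<close> is the set of all
  coordinate vectors of \<open>P\<close>, and \<open>homog d f\<close> says that \<open>f\<close> is homogeneous of (multi-)degree \<open>d\<close>.
  This covers both weighted projective spaces and products of two of them, so that the Zariski
  topology, regular functions and morphisms need only be defined once.
\<close>

record ('p, 'i, 'd) coord_space =
  points :: "'p set"
  coords :: "'p \<Rightarrow> ('i \<Rightarrow> complex) set"
  homog :: "'d \<Rightarrow> 'i cpoly \<Rightarrow> bool"

definition zariski :: "('p, 'i::finite, 'd) coord_space \<Rightarrow> 'p topology" where
  "zariski S = topology_generated_by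
     {{P \<in> points S. \<forall>x\<in>coords S P. peval f x \<noteq> 0} | f. \<exists>d. homog S d f}"

text \<open>A function on \<open>W\<close> is regular if locally it is a quotient of homogeneous polynomials of the
  same degree.\<close>

definition regular_on ::
  "('p, 'i::finite, 'd) coord_space \<Rightarrow> 'p set \<Rightarrow> ('p \<Rightarrow> complex) \<Rightarrow> bool" where
  "regular_on S W f \<longleftrightarrow>
     (\<forall>P\<in>W. \<exists>N d g h. openin (zariski S) N \<and> P \<in> N \<and> homog S d g \<and> homog S d h \<and>
        (\<forall>Q\<in>W \<inter> N. \<forall>x\<in>coords S Q. peval h x \<noteq> 0 \<and> f Q = peval g x / peval h x))"

definition morphism ::
  "('p, 'i::finite, 'd) coord_space \<Rightarrow> 'p set \<Rightarrow>
   ('q, 'j::finite, 'e) coord_space \<Rightarrow> 'q set \<Rightarrow> ('p \<Rightarrow> 'q) \<Rightarrow> bool" where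
  "morphism S U T Z \<phi> \<longleftrightarrow>
     continuous_map (subtopology (zariski S) U) (subtopology (zariski T) Z) \<phi> \<and>
     (\<forall>W f. openin (subtopology (zariski T) Z) W \<and> regular_on T W f \<longrightarrow>
        regular_on S {P \<in> U. \<phi> P \<in> W} (f \<circ> \<phi>))"

definition dense_open :: "'p topology \<Rightarrow> 'p set \<Rightarrow> bool" where
  "dense_open Y U \<longleftrightarrow> openin Y U \<and> Y closure_of U = topspace Y"


type_synonym 'i wpoint = "('i \<Rightarrow> complex) set"

definition wpoint :: "('i \<Rightarrow> nat) \<Rightarrow> ('i \<Rightarrow> complex) \<Rightarrow> 'i wpoint" where
  "wpoint w z = {\<lambda>i. t ^ w i * z i | t. t \<noteq> 0}"

definition wproj :: "('i::finite \<Rightarrow> nat) \<Rightarrow> ('i wpoint, 'i, nat) coord_space" where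
  "wproj w = \<lparr>points = {wpoint w z | z. z \<noteq> (\<lambda>_. 0)}, coords = (\<lambda>P. P), homog = whomog w\<rparr>"

definition wproj_prod ::
  "('i::finite \<Rightarrow> nat) \<Rightarrow> ('j::finite \<Rightarrow> nat) \<Rightarrow>
   ('i wpoint \<times> 'j wpoint, 'i + 'j, nat \<times> nat) coord_space" where
  "wproj_prod w v =
     \<lparr>points = points (wproj w) \<times> points (wproj v),
      coords = (\<lambda>(P, Q). {case_sum x y | x y. x \<in> P \<and> y \<in> Q}),
      homog = (\<lambda>(d, e) f. whomog (case_sum w (\<lambda>_. 0)) d f \<and> whomog (case_sum (\<lambda>_. 0) v) e f)\<rparr>"


text \<open>
  The index \<open>None\<close> plays the role of 0 and \<open>Some i\<close> that of \<open>1, \<dots>, n\<close>. The first set is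
  \<open>x\<^sub>0\<^sup>l + p(x\<^sub>1, \<dots>, x\<^sub>n) = 0\<close>, the second \<open>p(z) - q(t) = 0\<close>.
\<close>

definition cyclic_hypersurface ::
  "('n::finite option \<Rightarrow> nat) \<Rightarrow> nat \<Rightarrow> 'n cpoly \<Rightarrow> 'n option wpoint set" where
  "cyclic_hypersurface w l p =
     {P \<in> points (wproj w). \<forall>x\<in>P. x None ^ l + peval p (\<lambda>i. x (Some i)) = 0}"

definition difference_hypersurface ::
  "('n::finite + 'm::finite \<Rightarrow> nat) \<Rightarrow> 'n cpoly \<Rightarrow> 'm cpoly \<Rightarrow> ('n + 'm) wpoint set" where
  "difference_hypersurface u p q =
     {R \<in> points (wproj u). \<forall>z\<in>R. peval p (\<lambda>i. z (Inl i)) - peval q (\<lambda>j. z (Inr j)) = 0}"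

definition twist_weights ::
  "('n option \<Rightarrow> nat) \<Rightarrow> ('m option \<Rightarrow> nat) \<Rightarrow> 'n + 'm \<Rightarrow> nat" where
  "twist_weights w v = case_sum (\<lambda>i. v None * w (Some i)) (\<lambda>j. w None * v (Some j))"

text \<open>
  The twist map as a multivalued map: \<open>twist_map w v (P, Q)\<close> is the set of all values obtained from
  the coordinates of \<open>P\<close> and \<open>Q\<close> by choosing a root \<open>s\<close> for \<open>y\<^sub>0\<close> and a root \<open>r\<close> for \<open>x\<^sub>0\<close>. It is
  empty where the formula gives only the zero vector. Different choices of roots generally give
  \<open>gcd w\<^sub>0 v\<^sub>0\<close> different values, so single-valuedness can be expected only if
  \<open>w\<^sub>0\<close> and \<open>v\<^sub>0\<close> are coprime.
\<close>

definition twist_map ::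
  "('n::finite option \<Rightarrow> nat) \<Rightarrow> ('m::finite option \<Rightarrow> nat) \<Rightarrow>
   'n option wpoint \<times> 'm option wpoint \<Rightarrow> ('n + 'm) wpoint set" where
  "twist_map w v = (\<lambda>(P, Q). {wpoint (twist_weights w v) z | z x y s r.
     x \<in> P \<and> y \<in> Q \<and> s ^ w None = y None \<and> r ^ v None = x None \<and>
     z = case_sum (\<lambda>i. s ^ w (Some i) * x (Some i)) (\<lambda>j. r ^ v (Some j) * y (Some j)) \<and>
     z \<noteq> (\<lambda>_. 0)})"

text \<open>
  Adjoining a \<open>k\<close>-th root of \<open>x\<^sub>0\<close>: the finite surjective map
  \<open>(r, x\<^sub>1, \<dots>, x\<^sub>n) \<mapsto> (r\<^sup>k, x\<^sub>1, \<dots>, x\<^sub>n)\<close> goes from the weighted projective space with weights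
  \<open>(w\<^sub>0, k w\<^sub>1, \<dots>, k w\<^sub>n)\<close> to the one with weights \<open>(w\<^sub>0, \<dots>, w\<^sub>n)\<close>, and \<open>root_points k w P\<close> is its
  fibre over \<open>P\<close>.
\<close>

definition root_weights :: "nat \<Rightarrow> ('n option \<Rightarrow> nat) \<Rightarrow> 'n option \<Rightarrow> nat" where
  "root_weights k w = case_option (w None) (\<lambda>i. k * w (Some i))"

definition root_points ::
  "nat \<Rightarrow> ('n::finite option \<Rightarrow> nat) \<Rightarrow> 'n option wpoint \<Rightarrow> 'n option wpoint set" where
  "root_points k w P =
     {P' \<in> points (wproj (root_weights k w)). \<forall>z\<in>P'. z(None := z None ^ k) \<in> P}"

text \<open>
  The twist map on \<open>U\<close> is rational in the roots: it is a morphism on the part over \<open>U\<close> of the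
  product of the two root covers.
\<close>

definition twist_rational_in_roots ::
  "('n::finite option \<Rightarrow> nat) \<Rightarrow> ('m::finite option \<Rightarrow> nat) \<Rightarrow>
   ('n option wpoint \<times> 'm option wpoint) set \<Rightarrow> ('n + 'm) wpoint set \<Rightarrow> bool" where
  "twist_rational_in_roots w v U Z \<longleftrightarrow>
     (\<exists>\<psi>. morphism
        (wproj_prod (root_weights (v None) w) (root_weights (w None) v))
        (\<Union>(P, Q)\<in>U. root_points (v None) w P \<times> root_points (w None) v Q)
        (wproj (twist_weights w v)) Z \<psi> \<and>
      (\<forall>(P, Q)\<in>U.
        twist_map w v (P, Q) = \<psi> ` (root_points (v None) w P \<times> root_points (w None) v Q)))"

end

theory Submission
  imports Defs "HOL-Complex_Analysis.Conformal_Mappings" "HOL-Number_Theory.Cong"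
begin

text \<open>
  Write \<open>a = w\<^sub>0\<close>, \<open>b = v\<^sub>0\<close>, and let \<open>s\<^sup>a = y\<^sub>0\<close>, \<open>r\<^sup>b = x\<^sub>0\<close> be the chosen roots. Homogeneity gives
  \<open>p(z) = y\<^sub>0\<^sup>l p(x)\<close> and \<open>q(t) = x\<^sub>0\<^sup>l q(y)\<close> for the value \<open>(z, t)\<close> of the twist map, and both
  are \<open>- x\<^sub>0\<^sup>l y\<^sub>0\<^sup>l\<close> on the product of the two hypersurfaces. So the values lie in \<open>X\<close>, and they are
  nonzero vectors over the set \<open>U\<close> where \<open>x\<^sub>0\<close> and \<open>y\<^sub>0\<close> do not vanish. Rescaling the coordinates of
  the two points by \<open>\<lambda>\<^sup>b\<close> and \<open>\<mu>\<^sup>a\<close> rescales \<open>r, s\<close> by \<open>\<lambda>\<^sup>a, \<mu>\<^sup>b\<close> and the value by \<open>\<lambda>\<mu>\<close>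
  (\<open>twist_vec_wscale\<close>). Hence every value is already obtained from fixed coordinates and a choice
  among finitely many roots.

  Conversely, let \<open>(z, t)\<close> be a point of \<open>X\<close> with \<open>p(z) \<noteq> 0\<close>. A preimage can be rescaled so that
  \<open>s = y\<^sub>0 = 1\<close> and so that the twisted vector is \<open>(z, t)\<close> itself. Then it is determined by \<open>r\<close>, which
  satisfies \<open>r\<^sup>b\<^sup>l = - p(z)\<close>. Every solution \<open>r\<close> gives a preimage in \<open>U\<close>, so the fibre is nonempty and
  finite over the locus \<open>p(z) \<noteq> 0\<close> of \<open>X\<close> (\<open>nonbranch_X_subset_image\<close>, \<open>finite_fibre\<close>).

  What remains on the topological side is that \<open>x\<^sub>0 y\<^sub>0 \<noteq> 0\<close> and \<open>p(z) \<noteq> 0\<close> are dense conditions. Zariski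
  open sets are open for the classical topology of the coordinates (\<open>zariski_open_classical_nhd\<close>),
  so it suffices to move a point slightly. By the open mapping theorem on a complex line, a
  polynomial that is not identically zero takes all small values near any of its zeros
  (\<open>peval_locally_onto\<close>); this allows \<open>x\<^sub>0\<close>, or the common value of \<open>p\<close> and \<open>q\<close>, to be made nonzero
  while the equation is preserved.

  A map is a morphism as soon as homogeneous polynomials pull back to homogeneous polynomials, up to a
  nonzero factor depending only on the point and the degree (\<open>morphismI\<close>): the factor
  disappears from vanishing loci and from quotients. On the root covers the twist map is given by
  polynomials. For coprime \<open>a\<close> and \<open>b\<close>, the exponents of \<open>s\<close> and \<open>r\<close> in a pulled back monomial
  are, modulo \<open>a\<close> and \<open>b\<close>, determined by the degree alone. A common monomial in \<open>s\<close> and \<open>r\<close> therefore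
  factors out, and the rest is a polynomial in \<open>x\<close> and \<open>y\<close> up to a power of \<open>x\<^sub>0\<close>
  (\<open>coprime_pullback\<close>).
\<close>

section \<open>Polynomials and monomial substitutions\<close>

lemma peval_superset:
  assumes "finite A" "Poly_Mapping.keys f \<subseteq> A"
  shows "peval f x = (\<Sum>m\<in>A. Poly_Mapping.lookup f m * (\<Prod>i\<in>UNIV. x i ^ Poly_Mapping.lookup m i))"
  unfolding peval_def using assms
  by (intro sum.mono_neutral_left) (auto simp: in_keys_iff)

lemma peval_zero [simp]: "peval 0 x = 0"
  by (simp add: peval_def)

lemma peval_add: "peval (f + g) x = peval f x + peval g x"
proof -
  let ?A = "Poly_Mapping.keys f \<union> Poly_Mapping.keys g"
  have "Poly_Mapping.keys (f + g) \<subseteq> ?A" by (rule Poly_Mapping.keys_add)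
  then show ?thesis
    by (simp add: peval_superset[of ?A] lookup_add algebra_simps sum.distrib)
qed

lemma peval_sum: "peval (sum F A) x = (\<Sum>a\<in>A. peval (F a) x)"
  by (induction A rule: infinite_finite_induct) (auto simp: peval_add)

lemma peval_single:
  "peval (Poly_Mapping.single m c) x = c * (\<Prod>i\<in>UNIV. x i ^ Poly_Mapping.lookup m i)"
  by (subst peval_superset[of "{m}"]) auto

text \<open>
  Each term keeps its coefficient and gets a new exponent vector, which may be chosen arbitrarily
  (terms with equal new vectors are added). All pullbacks below have this form.
\<close>

definition map_exponents ::
  "(('i::finite \<Rightarrow>\<^sub>0 nat) \<Rightarrow> 'j::finite \<Rightarrow> nat) \<Rightarrow> 'i cpoly \<Rightarrow> 'j cpoly" where
  "map_exponents M f =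
     (\<Sum>m\<in>Poly_Mapping.keys f. Poly_Mapping.single (Abs_poly_mapping (M m)) (Poly_Mapping.lookup f m))"

lemma lookup_Abs_finite [simp]:
  fixes e :: "'i::finite \<Rightarrow> nat"
  shows "Poly_Mapping.lookup (Abs_poly_mapping e) = e"
  by (rule lookup_Abs_poly_mapping) simp

lemma peval_map_exponents:
  "peval (map_exponents M f) x =
     (\<Sum>m\<in>Poly_Mapping.keys f. Poly_Mapping.lookup f m * (\<Prod>j\<in>UNIV. x j ^ M m j))"
  by (simp add: map_exponents_def peval_sum peval_single)

lemma whomog_map_exponents:
  assumes "\<And>m. m \<in> Poly_Mapping.keys f \<Longrightarrow> (\<Sum>j\<in>UNIV. w j * M m j) = d"
  shows "whomog w d (map_exponents M f)"
proof -
  have "Poly_Mapping.keys (map_exponents M f) \<subseteq> (\<lambda>m. Abs_poly_mapping (M m)) ` Poly_Mapping.keys f"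
    unfolding map_exponents_def
    by (rule order_trans[OF keys_sum]) (auto split: if_splits)
  then show ?thesis
    using assms by (auto simp: whomog_def)
qed

section \<open>Weighted scaling and weighted projective points\<close>

definition wscale :: "('i \<Rightarrow> nat) \<Rightarrow> complex \<Rightarrow> ('i \<Rightarrow> complex) \<Rightarrow> 'i \<Rightarrow> complex" where
  "wscale w t z = (\<lambda>i. t ^ w i * z i)"

lemma wscale_wscale: "wscale w t (wscale w u z) = wscale w (t * u) z"
  by (simp add: wscale_def power_mult_distrib mult_ac)

lemma wscale_one [simp]: "wscale w 1 z = z"
  by (simp add: wscale_def)

lemma wscale_eq_0_iff: "t \<noteq> 0 \<Longrightarrow> wscale w t z = (\<lambda>_. 0) \<longleftrightarrow> z = (\<lambda>_. 0)"
  by (auto simp: wscale_def fun_eq_iff)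

lemma wpoint_eq_wscale: "wpoint w z = {wscale w t z | t. t \<noteq> 0}"
  by (simp add: wpoint_def wscale_def)

lemma wpoint_self [simp]: "z \<in> wpoint w z"
  unfolding wpoint_eq_wscale by (rule CollectI, rule exI[of _ 1]) simp

lemma wpoint_wscale: "t \<noteq> 0 \<Longrightarrow> wpoint w (wscale w t z) = wpoint w z"
proof -
  assume t: "t \<noteq> 0"
  have "wscale w u z = wscale w (u / t) (wscale w t z)" for u
    using t by (simp add: wscale_wscale)
  then have "\<exists>u'. wscale w u z = wscale w u' (wscale w t z) \<and> u' \<noteq> 0" if "u \<noteq> 0" for u
    using t that by (metis divide_eq_0_iff)
  moreover have "\<exists>u'. wscale w u (wscale w t z) = wscale w u' z \<and> u' \<noteq> 0" if "u \<noteq> 0" for u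
    using t that unfolding wscale_wscale by (metis mult_eq_0_iff)
  ultimately show ?thesis
    unfolding wpoint_eq_wscale by fast
qed

lemma wpoint_eqI: "x \<in> wpoint w z \<Longrightarrow> wpoint w x = wpoint w z"
  by (auto simp: wpoint_wscale wpoint_eq_wscale[of w z])

lemma points_wproj: "points (wproj w) = {wpoint w z | z. z \<noteq> (\<lambda>_. 0)}"
  by (simp add: wproj_def)

lemma coords_wproj [simp]: "coords (wproj w) P = P"
  by (simp add: wproj_def)

lemma homog_wproj [simp]: "homog (wproj w) = whomog w"
  by (simp add: wproj_def)

lemma point_eq_wpoint:
  assumes "P \<in> points (wproj w)" "x \<in> P"
  shows "P = wpoint w x" "x \<noteq> (\<lambda>_. 0)"
proof -
  from assms(1) obtain z where z: "P = wpoint w z" "z \<noteq> (\<lambda>_. 0)"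
    by (auto simp: points_wproj)
  then show "P = wpoint w x" using wpoint_eqI assms(2) by metis
  obtain t where "t \<noteq> 0" "x = wscale w t z"
    using z assms(2) by (auto simp: wpoint_eq_wscale)
  with z show "x \<noteq> (\<lambda>_. 0)" using wscale_eq_0_iff by metis
qed

lemma wpoint_in_points_iff: "wpoint w x \<in> points (wproj w) \<longleftrightarrow> x \<noteq> (\<lambda>_. 0)"
  using point_eq_wpoint(2)[of "wpoint w x" w x] by (auto simp: points_wproj)

lemma peval_wscale:
  assumes "whomog w d f"
  shows "peval f (wscale w t x) = t ^ d * peval f x"
proof -
  have "(\<Prod>i\<in>UNIV. wscale w t x i ^ Poly_Mapping.lookup m i) =
      t ^ d * (\<Prod>i\<in>UNIV. x i ^ Poly_Mapping.lookup m i)" if "m \<in> Poly_Mapping.keys f" for m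
    using assms that
    by (auto simp: whomog_def wscale_def power_mult_distrib prod.distrib power_mult[symmetric]
        power_sum[symmetric])
  then show ?thesis
    by (simp add: peval_def sum_distrib_left mult_ac)
qed

lemma peval_at_zero:
  assumes "whomog w d f" "d > 0"
  shows "peval f (\<lambda>_. 0) = 0"
  using peval_wscale[OF assms(1), of 0 "\<lambda>_. 0"] assms(2) by (simp add: wscale_def zero_power)

lemma sum_UNIV_option: "(\<Sum>i\<in>UNIV. f i) = f None + (\<Sum>i\<in>UNIV. f (Some i))"
  for f :: "'n::finite option \<Rightarrow> 'a::comm_monoid_add"
  by (simp add: UNIV_option_conv sum.reindex)

lemma prod_UNIV_option: "(\<Prod>i\<in>UNIV. f i) = f None * (\<Prod>i\<in>UNIV. f (Some i))"
  for f :: "'n::finite option \<Rightarrow> 'a::comm_monoid_mult"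
  by (simp add: UNIV_option_conv prod.reindex)

lemma sum_UNIV_sum: "(\<Sum>i\<in>UNIV. f i) = (\<Sum>i\<in>UNIV. f (Inl i)) + (\<Sum>j\<in>UNIV. f (Inr j))"
  for f :: "'n::finite + 'm::finite \<Rightarrow> 'a::comm_monoid_add"
  by (subst UNIV_Plus_UNIV[symmetric], subst sum.Plus) (auto simp: )

lemma prod_UNIV_sum: "(\<Prod>i\<in>UNIV. f i) = (\<Prod>i\<in>UNIV. f (Inl i)) * (\<Prod>j\<in>UNIV. f (Inr j))"
  for f :: "'n::finite + 'm::finite \<Rightarrow> 'a::comm_monoid_mult"
  by (subst UNIV_Plus_UNIV[symmetric], subst prod.Plus) (auto simp: )

section \<open>Zariski topology and morphisms in homogeneous coordinates\<close>

text \<open>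
  The one property of coordinates that the topological arguments use: two coordinate vectors of the
  same point give the same values up to a factor that depends on the degree, but not on the
  polynomial. It holds for weighted projective spaces and for their products.
\<close>

definition homogeneous_coords :: "('p, 'i::finite, 'd) coord_space \<Rightarrow> bool" where
  "homogeneous_coords S \<longleftrightarrow>
     (\<forall>P\<in>points S. \<forall>x\<in>coords S P. \<forall>y\<in>coords S P. \<forall>d. \<exists>c. c \<noteq> 0 \<and>
        (\<forall>f. homog S d f \<longrightarrow> peval f y = c * peval f x))"

lemma homogeneous_coordsD:
  assumes "homogeneous_coords S" "P \<in> points S" "x \<in> coords S P" "y \<in> coords S P"
  obtains c where "c \<noteq> 0" "\<And>f. homog S d f \<Longrightarrow> peval f y = c * peval f x"
  using assms unfolding homogeneous_coords_def by metis

lemma homogeneous_coords_wproj: "homogeneous_coords (wproj w)"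
  unfolding homogeneous_coords_def
proof (intro ballI allI)
  fix P x y d assume "P \<in> points (wproj w)" "x \<in> coords (wproj w) P" "y \<in> coords (wproj w) P"
  then have "y \<in> wpoint w x" using point_eq_wpoint by fastforce
  then obtain t where "t \<noteq> 0" "y = wscale w t x" by (auto simp: wpoint_eq_wscale)
  then show "\<exists>c. c \<noteq> 0 \<and> (\<forall>f. homog (wproj w) d f \<longrightarrow> peval f y = c * peval f x)"
    by (intro exI[of _ "t ^ d"]) (auto simp: peval_wscale)
qed

lemma points_wproj_prod [simp]:
  "points (wproj_prod w v) = points (wproj w) \<times> points (wproj v)"
  by (simp add: wproj_prod_def)

lemma coords_wproj_prod [simp]:
  "coords (wproj_prod w v) (P, Q) = {case_sum x y | x y. x \<in> P \<and> y \<in> Q}"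
  by (simp add: wproj_prod_def)

lemma homog_wproj_prod [simp]:
  "homog (wproj_prod w v) (d, e) f \<longleftrightarrow>
     whomog (case_sum w (\<lambda>_. 0)) d f \<and> whomog (case_sum (\<lambda>_. 0) v) e f"
  by (simp add: wproj_prod_def)

lemma peval_bihomog:
  assumes "homog (wproj_prod w v) (d, e) f"
  shows "peval f (case_sum (wscale w t x) (wscale v u y)) = t ^ d * u ^ e * peval f (case_sum x y)"
proof -
  have "case_sum (wscale w t x) (wscale v u y) =
      wscale (case_sum w (\<lambda>_. 0)) t (wscale (case_sum (\<lambda>_. 0) v) u (case_sum x y))"
    by (auto simp: wscale_def fun_eq_iff split: sum.split)
  moreover have "whomog (case_sum w (\<lambda>_. 0)) d f" "whomog (case_sum (\<lambda>_. 0) v) e f"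
    using assms by simp_all
  ultimately show ?thesis by (simp only: peval_wscale mult.assoc)
qed

lemma homogeneous_coords_wproj_prod: "homogeneous_coords (wproj_prod w v)"
  unfolding homogeneous_coords_def
proof (intro ballI allI)
  fix PQ X Y and de :: "nat \<times> nat"
  assume *: "PQ \<in> points (wproj_prod w v)" "X \<in> coords (wproj_prod w v) PQ"
    "Y \<in> coords (wproj_prod w v) PQ"
  obtain P Q d e where PQ: "PQ = (P, Q)" and de: "de = (d, e)" by (metis surj_pair)
  from * PQ obtain x y x' y' where X: "X = case_sum x y" "x \<in> P" "y \<in> Q"
    and Y: "Y = case_sum x' y'" "x' \<in> P" "y' \<in> Q"
    and pts: "P \<in> points (wproj w)" "Q \<in> points (wproj v)" by auto
  have "x' \<in> wpoint w x" "y' \<in> wpoint v y"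
    using point_eq_wpoint(1)[OF pts(1)] point_eq_wpoint(1)[OF pts(2)] X Y by blast+
  then obtain t u where "t \<noteq> 0" "x' = wscale w t x" "u \<noteq> 0" "y' = wscale v u y"
    by (auto simp: wpoint_eq_wscale)
  then show "\<exists>c. c \<noteq> 0 \<and> (\<forall>f. homog (wproj_prod w v) de f \<longrightarrow> peval f Y = c * peval f X)"
    unfolding de X Y by (intro exI[of _ "t ^ d * u ^ e"]) (auto simp: peval_bihomog simp del: homog_wproj_prod)
qed

lemma peval_one: "peval 1 x = 1"
  using peval_single[of 0 1 x] by simp

text \<open>
  The constant polynomial 1 cuts out the whole space as a basic open set, which is why it must be
  homogeneous of some degree.
\<close>

lemma topspace_zariski:
  assumes "homog S d 1"
  shows "topspace (zariski S) = points S"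
proof -
  have "{P \<in> points S. \<forall>x\<in>coords S P. peval 1 x \<noteq> 0} = points S"
    by (auto simp: peval_one)
  then have "points S \<in> {{P \<in> points S. \<forall>x\<in>coords S P. peval f x \<noteq> 0} | f. \<exists>d. homog S d f}"
    using assms by (intro CollectI exI[of _ 1] conjI exI[of _ d]) simp_all
  then show ?thesis
    unfolding zariski_def topology_generated_by_topspace by blast
qed

lemma topspace_zariski_wproj [simp]: "topspace (zariski (wproj w)) = points (wproj w)"
  by (rule topspace_zariski[of _ 0]) (simp add: whomog_def)

lemma topspace_zariski_wproj_prod [simp]:
  "topspace (zariski (wproj_prod w v)) = points (wproj w) \<times> points (wproj v)"
  by (subst topspace_zariski[of _ "(0, 0)"]) (simp_all add: whomog_def keys_one)

lemma openin_zariski_nonvanishing: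
  assumes "homog S d f"
  shows "openin (zariski S) {P \<in> points S. \<forall>x\<in>coords S P. peval f x \<noteq> 0}"
  unfolding zariski_def by (rule topology_generated_by_Basis) (use assms in auto)

lemma continuous_on_peval:
  "continuous_on UNIV (peval f :: ('i::finite \<Rightarrow> complex) \<Rightarrow> complex)"
  unfolding peval_def
  by (intro continuous_intros continuous_on_product_coordinates)

text \<open>
  A nonvanishing locus pulls back to a classically open set of coordinate vectors because polynomials are
  continuous, and this passes to finite intersections and unions. Density in the Zariski
  topology can thus be tested by small perturbations of coordinates.
\<close>

lemma zariski_open_classical_nhd:
  fixes S :: "('p, 'i::finite, 'd) coord_space"
  assumes S: "homogeneous_coords S" and "openin (zariski S) N" "P \<in> N" "x \<in> coords S P"
  obtains A where "open A" "x \<in> A" "\<And>Q y. Q \<in> points S \<Longrightarrow> y \<in> coords S Q \<Longrightarrow> y \<in> A \<Longrightarrow> Q \<in> N"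
proof -
  have "generate_topology_on {{P \<in> points S. \<forall>x\<in>coords S P. peval f x \<noteq> 0} | f. \<exists>d. homog S d f} N"
    using assms(2) unfolding zariski_def by (simp add: openin_topology_generated_by)
  then have "\<forall>P x. P \<in> N \<longrightarrow> x \<in> coords S P \<longrightarrow>
    (\<exists>A. open A \<and> x \<in> A \<and> (\<forall>Q y. Q \<in> points S \<longrightarrow> y \<in> coords S Q \<longrightarrow> y \<in> A \<longrightarrow> Q \<in> N))"
  proof induction
    case Empty
    then show ?case by simp
  next
    case (Int a b)
    show ?case
    proof (intro allI impI)
      fix P x assume "P \<in> a \<inter> b" "x \<in> coords S P"
      then have P: "P \<in> a" "P \<in> b" "x \<in> coords S P" by auto
      from Int.IH(1)[rule_format, OF P(1,3)] Int.IH(2)[rule_format, OF P(2,3)] obtain A B where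
        "open A" "x \<in> A" "\<forall>Q y. Q \<in> points S \<longrightarrow> y \<in> coords S Q \<longrightarrow> y \<in> A \<longrightarrow> Q \<in> a"
        "open B" "x \<in> B" "\<forall>Q y. Q \<in> points S \<longrightarrow> y \<in> coords S Q \<longrightarrow> y \<in> B \<longrightarrow> Q \<in> b"
        by (elim exE conjE)
      then show "\<exists>A. open A \<and> x \<in> A \<and>
          (\<forall>Q y. Q \<in> points S \<longrightarrow> y \<in> coords S Q \<longrightarrow> y \<in> A \<longrightarrow> Q \<in> a \<inter> b)"
        by (intro exI[of _ "A \<inter> B"]) auto
    qed
  next
    case (UN K)
    show ?case
    proof (intro allI impI)
      fix P x assume "P \<in> \<Union> K" "x \<in> coords S P"
      then obtain k where k: "k \<in> K" "P \<in> k" by auto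
      obtain A where
        "open A" "x \<in> A" "\<forall>Q y. Q \<in> points S \<longrightarrow> y \<in> coords S Q \<longrightarrow> y \<in> A \<longrightarrow> Q \<in> k"
        using UN.IH[OF k(1), rule_format, OF k(2) \<open>x \<in> coords S P\<close>] by (elim exE conjE)
      with k(1) show "\<exists>A. open A \<and> x \<in> A \<and>
          (\<forall>Q y. Q \<in> points S \<longrightarrow> y \<in> coords S Q \<longrightarrow> y \<in> A \<longrightarrow> Q \<in> \<Union> K)"
        by (intro exI[of _ A]) blast
    qed
  next
    case (Basis s)
    then obtain f d where s: "s = {P \<in> points S. \<forall>x\<in>coords S P. peval f x \<noteq> 0}"
      and f: "homog S d f" by auto
    have "open {y. peval f y \<noteq> 0}"
      using open_vimage[OF _ continuous_on_peval, of "- {0}" f] by (simp add: vimage_def open_Compl)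
    moreover have "Q \<in> s" if pts: "Q \<in> points S" "y \<in> coords S Q" "peval f y \<noteq> 0" for Q y
    proof -
      have "peval f y' \<noteq> 0" if y': "y' \<in> coords S Q" for y'
      proof -
        obtain c where "c \<noteq> 0" "peval f y' = c * peval f y"
          using homogeneous_coordsD[where d = d, OF S pts(1) pts(2) y'] f by metis
        with pts(3) show ?thesis by simp
      qed
      with pts(1) show ?thesis unfolding s by blast
    qed
    ultimately show ?case
      using s by (intro allI impI exI[of _ "{y. peval f y \<noteq> 0}"]) auto
  qed
  from this[rule_format, OF assms(3,4)] show ?thesis using that by (elim exE conjE) simp
qed

text \<open>
  Vanishing of \<open>F g\<close> decides vanishing of \<open>g\<close> on the image, which gives continuity. In a quotient of two
  polynomials of degree \<open>d\<close> the factor \<open>c\<close> cancels, which gives regularity of pulled back functions;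
  for this, \<open>c\<close> must not depend on \<open>g\<close>.
\<close>

lemma morphismI:
  fixes S :: "('p, 'i::finite, 'd) coord_space" and T :: "('q, 'j::finite, 'e) coord_space"
  assumes T: "homogeneous_coords T" and topT: "topspace (zariski T) = points T"
    and topS: "topspace (zariski S) = points S"
    and U: "U \<subseteq> points S" "\<And>P. P \<in> U \<Longrightarrow> coords S P \<noteq> {}"
    and Z: "Z \<subseteq> points T" "\<phi> ` U \<subseteq> Z"
    and pull: "\<And>d. \<exists>e F. (\<forall>g. homog T d g \<longrightarrow> homog S e (F g)) \<and>
      (\<forall>P\<in>U. \<forall>x\<in>coords S P. \<exists>z\<in>coords T (\<phi> P). \<exists>c. c \<noteq> 0 \<and>
         (\<forall>g. homog T d g \<longrightarrow> peval g z = c * peval (F g) x))"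
  shows "morphism S U T Z \<phi>"
proof -
  \<comment> \<open>The factor may be taken with respect to any coordinates of the image point.\<close>
  have pull': "\<exists>e F. (\<forall>g. homog T d g \<longrightarrow> homog S e (F g)) \<and>
      (\<forall>P\<in>U. \<forall>x\<in>coords S P. \<forall>z\<in>coords T (\<phi> P). \<exists>c. c \<noteq> 0 \<and>
         (\<forall>g. homog T d g \<longrightarrow> peval g z = c * peval (F g) x))" for d
  proof -
    obtain e F where F: "\<forall>g. homog T d g \<longrightarrow> homog S e (F g)"
      and ev: "\<And>P x. P \<in> U \<Longrightarrow> x \<in> coords S P \<Longrightarrow> \<exists>z\<in>coords T (\<phi> P). \<exists>c. c \<noteq> 0 \<and>
         (\<forall>g. homog T d g \<longrightarrow> peval g z = c * peval (F g) x)"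
      using pull[of d] by blast
    have "\<exists>c. c \<noteq> 0 \<and> (\<forall>g. homog T d g \<longrightarrow> peval g z = c * peval (F g) x)"
      if P: "P \<in> U" "x \<in> coords S P" and z: "z \<in> coords T (\<phi> P)" for P x z
    proof -
      obtain z' c where z': "z' \<in> coords T (\<phi> P)" "c \<noteq> 0"
        and c: "\<And>g. homog T d g \<Longrightarrow> peval g z' = c * peval (F g) x"
        using ev[OF P] by auto
      have "\<phi> P \<in> points T" using Z P by auto
      then obtain c' where "c' \<noteq> 0" "\<And>g. homog T d g \<Longrightarrow> peval g z = c' * peval g z'"
        using homogeneous_coordsD[OF T _ z'(1) z] by metis
      with z'(2) c show ?thesis
        by (intro exI[of _ "c' * c"]) auto
    qed
    with F show ?thesis by blast
  qed
  have cont0: "continuous_map (subtopology (zariski S) U) (zariski T) \<phi>"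
    unfolding zariski_def[of T]
  proof (rule continuous_on_generated_topo)
    show "\<phi> ` topspace (subtopology (zariski S) U) \<subseteq>
        \<Union> {{P \<in> points T. \<forall>x\<in>coords T P. peval f x \<noteq> 0} | f. \<exists>d. homog T d f}"
      using Z topT unfolding zariski_def topology_generated_by_topspace by auto
  next
    fix N assume "N \<in> {{P \<in> points T. \<forall>x\<in>coords T P. peval f x \<noteq> 0} | f. \<exists>d. homog T d f}"
    then obtain g d where N: "N = {P \<in> points T. \<forall>x\<in>coords T P. peval g x \<noteq> 0}"
      and g: "homog T d g" by auto
    obtain e F where F: "\<And>g. homog T d g \<Longrightarrow> homog S e (F g)"
      and ev: "\<And>P x z. P \<in> U \<Longrightarrow> x \<in> coords S P \<Longrightarrow> z \<in> coords T (\<phi> P) \<Longrightarrow> \<exists>c. c \<noteq> 0 \<and>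
         (\<forall>g. homog T d g \<longrightarrow> peval g z = c * peval (F g) x)"
      using pull'[of d] by blast
    let ?B = "{P \<in> points S. \<forall>x\<in>coords S P. peval (F g) x \<noteq> 0}"
    have "\<phi> P \<in> N \<longleftrightarrow> P \<in> ?B" if P: "P \<in> U" for P
    proof -
      obtain x where x: "x \<in> coords S P" using U(2)[OF P] by auto
      obtain z where z: "z \<in> coords T (\<phi> P)" using pull[of d] P x by blast
      have pts: "P \<in> points S" "\<phi> P \<in> points T" using P U Z by auto
      have iff: "peval g z' \<noteq> 0 \<longleftrightarrow> peval (F g) x' \<noteq> 0"
        if "x' \<in> coords S P" "z' \<in> coords T (\<phi> P)" for x' z'
        using ev[OF P that] g by auto
      show ?thesis unfolding N using pts iff x z by blast
    qed
    then have "\<phi> -` N \<inter> topspace (subtopology (zariski S) U) = ?B \<inter> U"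
      using topS U by auto
    then show "openin (subtopology (zariski S) U) (\<phi> -` N \<inter> topspace (subtopology (zariski S) U))"
      using openin_zariski_nonvanishing[OF F[OF g]] by (auto simp: openin_subtopology)
  qed
  have cont: "continuous_map (subtopology (zariski S) U) (subtopology (zariski T) Z) \<phi>"
    using cont0 Z by (auto simp: continuous_map_in_subtopology)
  have "regular_on S {P \<in> U. \<phi> P \<in> W} (f \<circ> \<phi>)" if f: "regular_on T W f" for W f
    unfolding regular_on_def
  proof
    fix P assume "P \<in> {P \<in> U. \<phi> P \<in> W}"
    then have P: "P \<in> U" "\<phi> P \<in> W" by auto
    from f P(2) obtain N d g h where N: "openin (zariski T) N" "\<phi> P \<in> N"
      and gh: "homog T d g" "homog T d h"
      and quot: "\<And>Q x. Q \<in> W \<inter> N \<Longrightarrow> x \<in> coords T Q \<Longrightarrow>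
        peval h x \<noteq> 0 \<and> f Q = peval g x / peval h x"
      unfolding regular_on_def by meson
    obtain e F where F: "\<And>g. homog T d g \<Longrightarrow> homog S e (F g)"
      and ev: "\<And>P x. P \<in> U \<Longrightarrow> x \<in> coords S P \<Longrightarrow> \<exists>z\<in>coords T (\<phi> P). \<exists>c. c \<noteq> 0 \<and>
         (\<forall>g. homog T d g \<longrightarrow> peval g z = c * peval (F g) x)"
      using pull[of d] by blast
    have "openin (subtopology (zariski S) U) {P \<in> topspace (subtopology (zariski S) U). \<phi> P \<in> N}"
      using cont0 N(1) by (rule openin_continuous_map_preimage)
    then obtain N' where N': "openin (zariski S) N'" "{P \<in> U. \<phi> P \<in> N} = N' \<inter> U"
      using U topS by (auto simp: openin_subtopology inf.absorb2)
    have "peval (F h) x \<noteq> 0 \<and> (f \<circ> \<phi>) Q = peval (F g) x / peval (F h) x"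
      if Q: "Q \<in> {P \<in> U. \<phi> P \<in> W} \<inter> N'" "x \<in> coords S Q" for Q x
    proof -
      obtain z c where z: "z \<in> coords T (\<phi> Q)" "c \<noteq> 0"
        and c: "\<And>g. homog T d g \<Longrightarrow> peval g z = c * peval (F g) x"
        using ev[of Q x] Q by auto
      have "\<phi> Q \<in> W \<inter> N" using Q N' by blast
      from quot[OF this z(1)] show ?thesis using c gh z(2) by auto
    qed
    moreover have "P \<in> N'" using P N N' by blast
    ultimately show "\<exists>N d g h. openin (zariski S) N \<and> P \<in> N \<and> homog S d g \<and> homog S d h \<and>
        (\<forall>Q\<in>{P \<in> U. \<phi> P \<in> W} \<inter> N. \<forall>x\<in>coords S Q. peval h x \<noteq> 0 \<and>
          (f \<circ> \<phi>) Q = peval g x / peval h x)"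
      using N'(1) F[OF gh(1)] F[OF gh(2)] by blast
  qed
  with cont show ?thesis
    unfolding morphism_def by blast
qed

section \<open>Perturbing points of hypersurfaces\<close>

text \<open>
  The restriction of \<open>f\<close> to the complex line from the zero \<open>z\<close> to \<open>z1\<close> is holomorphic and takes
  the distinct values \<open>0\<close> and \<open>f(z1)\<close>, so it is open by the open mapping theorem.
\<close>

lemma peval_locally_onto:
  fixes f :: "'i::finite cpoly"
  assumes z: "peval f z = 0" and z1: "peval f z1 \<noteq> 0" and B: "open B" "z \<in> B"
  obtains \<epsilon> where "\<epsilon> > 0" "\<And>c. norm c < \<epsilon> \<Longrightarrow> \<exists>z'\<in>B. peval f z' = c"
proof -
  define \<gamma> where "\<gamma> = (\<lambda>(\<tau>::complex) i. z i + \<tau> * (z1 i - z i))"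
  have ends: "\<gamma> 0 = z" "\<gamma> 1 = z1" by (auto simp: \<gamma>_def)
  have hol: "(\<lambda>\<tau>. peval f (\<gamma> \<tau>)) holomorphic_on UNIV"
    unfolding peval_def \<gamma>_def by (intro holomorphic_intros)
  have "continuous_on UNIV \<gamma>"
    unfolding \<gamma>_def by (intro continuous_on_coordinatewise_then_product continuous_intros)
  then have "open (\<gamma> -` B)"
    using open_vimage B(1) by blast
  moreover have "\<not> (\<lambda>\<tau>. peval f (\<gamma> \<tau>)) constant_on UNIV"
    using z z1 ends unfolding constant_on_def by (metis UNIV_I)
  ultimately have "open ((\<lambda>\<tau>. peval f (\<gamma> \<tau>)) ` (\<gamma> -` B))"
    by (intro open_mapping_thm[OF hol open_UNIV connected_UNIV _ subset_UNIV])
  moreover have "0 \<in> (\<lambda>\<tau>. peval f (\<gamma> \<tau>)) ` (\<gamma> -` B)"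
    using z ends B(2) by (intro image_eqI[of _ _ 0]) auto
  ultimately obtain \<epsilon> where "\<epsilon> > 0" "ball 0 \<epsilon> \<subseteq> (\<lambda>\<tau>. peval f (\<gamma> \<tau>)) ` (\<gamma> -` B)"
    by (meson open_contains_ball)
  then show ?thesis
    by (intro that[of \<epsilon>]) (auto simp: subset_iff)
qed

text \<open>
  If \<open>f\<close> vanished identically, all its partial derivatives would vanish too, and the Jacobian
  criterion would fail at the vector \<open>(1, \<dots>, 1)\<close>.
\<close>

lemma quasi_smooth_nonzero:
  fixes f :: "'i::finite cpoly"
  assumes "quasi_smooth f"
  obtains z where "peval f z \<noteq> 0"
proof -
  have "\<exists>z. peval f z \<noteq> 0"
  proof (rule ccontr)
    assume "\<nexists>z. peval f z \<noteq> 0"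
    then have 0: "peval f z = 0" for z by simp
    have "(\<lambda>_::'i. 1::complex) \<noteq> (\<lambda>_. 0)" by (simp add: fun_eq_iff)
    with assms show False unfolding quasi_smooth_def by (auto simp: 0)
  qed
  then show ?thesis using that by blast
qed

lemma continuous_on_coordinate:
  assumes "continuous_on A g"
  shows "continuous_on A (\<lambda>a. g a i :: complex)"
  using continuous_on_compose2[OF continuous_on_product_coordinates assms] by simp

lemma continuous_on_case_option:
  "continuous_on UNIV (\<lambda>a. case_option (fst a) (snd a) :: 'n option \<Rightarrow> complex)"
proof (rule continuous_on_coordinatewise_then_product)
  fix i :: "'n option"
  show "continuous_on UNIV (\<lambda>a. case_option (fst a) (snd a) i :: complex)"
    by (cases i) (simp_all add: continuous_on_coordinate continuous_on_fst continuous_on_snd)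
qed

lemma continuous_on_case_sum:
  "continuous_on UNIV (\<lambda>a. case_sum (fst a) (snd a) :: 'n + 'm \<Rightarrow> complex)"
proof (rule continuous_on_coordinatewise_then_product)
  fix i :: "'n + 'm"
  show "continuous_on UNIV (\<lambda>a. case_sum (fst a) (snd a) i :: complex)"
    by (cases i) (simp_all add: continuous_on_coordinate continuous_on_fst continuous_on_snd)
qed

lemma case_option_nhds:
  fixes B :: "('n option \<Rightarrow> complex) set"
  assumes "open B" "case_option \<sigma> z \<in> B"
  obtains A C where "open A" "\<sigma> \<in> A" "open C" "z \<in> C"
    "\<And>\<sigma>' z'. \<sigma>' \<in> A \<Longrightarrow> z' \<in> C \<Longrightarrow> case_option \<sigma>' z' \<in> B"
proof -
  have V: "open ((\<lambda>a. case_option (fst a) (snd a)) -` B)"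
    using assms(1) open_vimage continuous_on_case_option by blast
  have "(\<sigma>, z) \<in> (\<lambda>a. case_option (fst a) (snd a)) -` B" using assms(2) by simp
  from open_prod_elim[OF V this] obtain A C where AC: "open A" "open C" "(\<sigma>, z) \<in> A \<times> C"
    "A \<times> C \<subseteq> (\<lambda>a. case_option (fst a) (snd a)) -` B" .
  have "case_option \<sigma>' z' \<in> B" if "\<sigma>' \<in> A" "z' \<in> C" for \<sigma>' z'
    using AC(4) that by auto
  with AC show ?thesis using that[of A C] by simp
qed

lemma case_sum_nhds:
  fixes B :: "('n + 'm \<Rightarrow> complex) set"
  assumes "open B" "case_sum x y \<in> B"
  obtains A C where "open A" "x \<in> A" "open C" "y \<in> C"
    "\<And>x' y'. x' \<in> A \<Longrightarrow> y' \<in> C \<Longrightarrow> case_sum x' y' \<in> B"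
proof -
  have V: "open ((\<lambda>a. case_sum (fst a) (snd a)) -` B)"
    using assms(1) open_vimage continuous_on_case_sum by blast
  have "(x, y) \<in> (\<lambda>a. case_sum (fst a) (snd a)) -` B" using assms(2) by simp
  from open_prod_elim[OF V this] obtain A C where AC: "open A" "open C" "(x, y) \<in> A \<times> C"
    "A \<times> C \<subseteq> (\<lambda>a. case_sum (fst a) (snd a)) -` B" .
  have "case_sum x' y' \<in> B" if "x' \<in> A" "y' \<in> C" for x' y'
    using AC(4) that by auto
  with AC show ?thesis using that[of A C] by simp
qed

text \<open>
  At a point with \<open>x\<^sub>0 = 0\<close>, choose a small \<open>\<sigma> \<noteq> 0\<close> as new \<open>x\<^sub>0\<close>; the polynomial takes
  the small value \<open>- \<sigma>\<^sup>l\<close> near the remaining coordinates.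
\<close>

lemma cyclic_cone_perturb:
  fixes f :: "'n::finite cpoly"
  assumes "peval f z1 \<noteq> 0" "l \<ge> 1" "x None ^ l + peval f (\<lambda>i. x (Some i)) = 0"
    and "open B" "x \<in> B"
  shows "\<exists>x'\<in>B. x' None \<noteq> 0 \<and> x' None ^ l + peval f (\<lambda>i. x' (Some i)) = 0"
proof (cases "x None = 0")
  case True
  with assms(2,3) have z: "peval f (\<lambda>i. x (Some i)) = 0" by (simp add: zero_power)
  have "case_option 0 (\<lambda>i. x (Some i)) = x"
    using True by (auto simp: fun_eq_iff split: option.split)
  with assms(4,5) obtain A C where A: "open A" "0 \<in> A" and C: "open C" "(\<lambda>i. x (Some i)) \<in> C"
    and AC: "\<And>\<sigma>' z'. \<sigma>' \<in> A \<Longrightarrow> z' \<in> C \<Longrightarrow> case_option \<sigma>' z' \<in> B"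
    using case_option_nhds[of B 0 "\<lambda>i. x (Some i)"] by metis
  obtain \<epsilon> where \<epsilon>: "\<epsilon> > 0" "\<And>c. norm c < \<epsilon> \<Longrightarrow> \<exists>z'\<in>C. peval f z' = c"
    using peval_locally_onto[OF z assms(1) C] by metis
  obtain \<delta> where \<delta>: "\<delta> > 0" "ball 0 \<delta> \<subseteq> A"
    using A open_contains_ball by blast
  \<comment> \<open>The bound by 1 ensures that the power of the new coordinate is no larger than the coordinate.\<close>
  define \<sigma> where "\<sigma> = min (min \<delta> \<epsilon>) 1 / 2"
  have \<sigma>: "0 < \<sigma>" "\<sigma> < \<delta>" "\<sigma> < \<epsilon>" "\<sigma> < 1"
    using \<delta>(1) \<epsilon>(1) by (auto simp: \<sigma>_def)
  have "\<sigma> ^ l \<le> \<sigma> ^ 1" using \<sigma> assms(2) by (intro power_decreasing) auto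
  then have "norm (- (of_real \<sigma> ^ l :: complex)) < \<epsilon>"
    using \<sigma> by (simp add: norm_power)
  then obtain z' where "z' \<in> C" "peval f z' = - (of_real \<sigma> ^ l)" using \<epsilon>(2) by blast
  moreover have "complex_of_real \<sigma> \<in> A" using \<sigma> \<delta>(2) by (auto simp: subset_iff)
  ultimately show ?thesis
    using AC[of "of_real \<sigma>" z'] \<sigma>(1) by (intro bexI[of _ "case_option (of_real \<sigma>) z'"]) auto
qed (use assms in blast)

text \<open>
  At a common zero, both polynomials take every sufficiently small value nearby, hence also a common
  nonzero one. This includes points where one of the two blocks of coordinates is zero.
\<close>

lemma difference_cone_perturb:
  fixes f :: "'n::finite cpoly" and g :: "'m::finite cpoly"
  assumes "peval f z1 \<noteq> 0" "peval g t1 \<noteq> 0"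
    and eq: "peval f (\<lambda>i. x (Inl i)) = peval g (\<lambda>j. x (Inr j))"
    and "open B" "x \<in> B"
  shows "\<exists>x'\<in>B. peval f (\<lambda>i. x' (Inl i)) = peval g (\<lambda>j. x' (Inr j)) \<and>
    peval f (\<lambda>i. x' (Inl i)) \<noteq> 0"
proof (cases "peval f (\<lambda>i. x (Inl i)) = 0")
  case True
  have "case_sum (\<lambda>i. x (Inl i)) (\<lambda>j. x (Inr j)) = x"
    by (auto simp: fun_eq_iff split: sum.split)
  with assms(4,5) obtain A C where A: "open A" "(\<lambda>i. x (Inl i)) \<in> A"
    and C: "open C" "(\<lambda>j. x (Inr j)) \<in> C"
    and AC: "\<And>x' y'. x' \<in> A \<Longrightarrow> y' \<in> C \<Longrightarrow> case_sum x' y' \<in> B"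
    using case_sum_nhds[of B "\<lambda>i. x (Inl i)" "\<lambda>j. x (Inr j)"] by metis
  obtain \<epsilon> where \<epsilon>: "\<epsilon> > 0" "\<And>c. norm c < \<epsilon> \<Longrightarrow> \<exists>z'\<in>A. peval f z' = c"
    using peval_locally_onto[OF True assms(1) A] by metis
  obtain \<delta> where \<delta>: "\<delta> > 0" "\<And>c. norm c < \<delta> \<Longrightarrow> \<exists>z'\<in>C. peval g z' = c"
    using peval_locally_onto[OF True[unfolded eq] assms(2) C] by metis
  define c where "c = complex_of_real (min \<delta> \<epsilon> / 2)"
  have "norm c < \<epsilon>" "norm c < \<delta>" "c \<noteq> 0"
    using \<delta>(1) \<epsilon>(1) by (auto simp: c_def)
  then obtain z' t' where "z' \<in> A" "peval f z' = c" "t' \<in> C" "peval g t' = c"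
    using \<delta>(2) \<epsilon>(2) by metis
  then show ?thesis
    using AC[of z' t'] \<open>c \<noteq> 0\<close> by (intro bexI[of _ "case_sum z' t'"]) auto
qed (use assms in blast)

section \<open>The twist map and the choice of roots\<close>

definition twist_vec ::
  "('n option \<Rightarrow> nat) \<Rightarrow> ('m option \<Rightarrow> nat) \<Rightarrow> ('n option \<Rightarrow> complex) \<Rightarrow>
   ('m option \<Rightarrow> complex) \<Rightarrow> complex \<Rightarrow> complex \<Rightarrow> 'n + 'm \<Rightarrow> complex" where
  "twist_vec w v x y s r =
     case_sum (\<lambda>i. s ^ w (Some i) * x (Some i)) (\<lambda>j. r ^ v (Some j) * y (Some j))"

lemma in_twist_map_iff:
  "R \<in> twist_map w v (P, Q) \<longleftrightarrow>
     (\<exists>x\<in>P. \<exists>y\<in>Q. \<exists>s r. s ^ w None = y None \<and> r ^ v None = x None \<and>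
        twist_vec w v x y s r \<noteq> (\<lambda>_. 0) \<and>
        R = wpoint (twist_weights w v) (twist_vec w v x y s r))"
  unfolding twist_map_def twist_vec_def by auto blast

lemma in_twist_mapI:
  assumes "x \<in> P" "y \<in> Q" "s ^ w None = y None" "r ^ v None = x None"
    and "twist_vec w v x y s r \<noteq> (\<lambda>_. 0)"
  shows "wpoint (twist_weights w v) (twist_vec w v x y s r) \<in> twist_map w v (P, Q)"
  unfolding in_twist_map_iff using assms by blast

lemma twist_vec_wscale:
  "twist_vec w v (wscale w (t ^ v None) x) (wscale v (u ^ w None) y)
      (u ^ v None * s) (t ^ w None * r) =
     wscale (twist_weights w v) (t * u) (twist_vec w v x y s r)"
  by (auto simp: twist_vec_def wscale_def twist_weights_def fun_eq_iff power_mult_distrib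
      power_mult[symmetric] mult_ac split: sum.split)

lemma complex_root_exists:
  assumes "n > 0"
  obtains r :: complex where "r ^ n = c"
  using exists_complex_root[of n c] assms by auto

text \<open>
  Passing to other coordinates of \<open>P\<close> and \<open>Q\<close> is compensated by rescaling the roots, so all values of
  the multivalued map arise from one pair of coordinate vectors.
\<close>

lemma twist_map_fixed_coords:
  assumes pos: "w None > 0" "v None > 0"
    and R: "R \<in> twist_map w v (wpoint w x, wpoint v y)"
  obtains s r where "s ^ w None = y None" "r ^ v None = x None"
    "R = wpoint (twist_weights w v) (twist_vec w v x y s r)"
proof -
  from R obtain x' y' s' r' where x': "x' \<in> wpoint w x" and y': "y' \<in> wpoint v y"
    and roots: "s' ^ w None = y' None" "r' ^ v None = x' None"
    and R': "R = wpoint (twist_weights w v) (twist_vec w v x' y' s' r')"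
    by (auto simp: in_twist_map_iff)
  obtain \<alpha> \<beta> where \<alpha>: "\<alpha> \<noteq> 0" "x' = wscale w \<alpha> x" and \<beta>: "\<beta> \<noteq> 0" "y' = wscale v \<beta> y"
    using x' y' by (auto simp: wpoint_eq_wscale)
  obtain t u where t: "t ^ v None = \<alpha>" and u: "u ^ w None = \<beta>"
    using complex_root_exists pos by metis
  have "t \<noteq> 0" "u \<noteq> 0" using t u \<alpha> \<beta> pos by (auto simp: zero_power)
  define s where "s = s' / u ^ v None"
  define r where "r = r' / t ^ w None"
  have s': "s' = u ^ v None * s" and r': "r' = t ^ w None * r"
    using \<open>t \<noteq> 0\<close> \<open>u \<noteq> 0\<close> by (auto simp: s_def r_def)
  have "R = wpoint (twist_weights w v) (twist_vec w v x y s r)"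
    unfolding R' \<alpha>(2) \<beta>(2) t[symmetric] u[symmetric] s' r' twist_vec_wscale
    using \<open>t \<noteq> 0\<close> \<open>u \<noteq> 0\<close> by (simp add: wpoint_wscale)
  moreover have "s ^ w None = y None" "r ^ v None = x None"
    using roots \<open>t \<noteq> 0\<close> \<open>u \<noteq> 0\<close> unfolding \<alpha>(2) \<beta>(2) t[symmetric] u[symmetric] s' r'
    by (auto simp: wscale_def power_mult_distrib power_mult[symmetric] mult.commute)
  ultimately show ?thesis using that by blast
qed

lemma finite_twist_map:
  assumes "w None > 0" "v None > 0"
  shows "finite (twist_map w v (wpoint w x, wpoint v y))"
proof (rule finite_subset)
  let ?F = "\<lambda>s r. wpoint (twist_weights w v) (twist_vec w v x y s r)"
  show "twist_map w v (wpoint w x, wpoint v y) \<subseteq>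
      (\<lambda>(s, r). ?F s r) ` ({s. s ^ w None = y None} \<times> {r. r ^ v None = x None})"
  proof
    fix R assume "R \<in> twist_map w v (wpoint w x, wpoint v y)"
    then obtain s r where "s ^ w None = y None" "r ^ v None = x None" "R = ?F s r"
      by (rule twist_map_fixed_coords[where w = w and v = v, OF assms])
    then show "R \<in> (\<lambda>(s, r). ?F s r) ` ({s. s ^ w None = y None} \<times> {r. r ^ v None = x None})"
      by (intro image_eqI[of _ _ "(s, r)"]) simp_all
  qed
qed (intro finite_imageI finite_cartesian_product finite_nth_roots assms)

lemma power_mod_root_of_unity: "\<zeta> ^ a = 1 \<Longrightarrow> \<zeta> ^ n = \<zeta> ^ (n mod a)" for \<zeta> :: complex
proof -
  assume "\<zeta> ^ a = 1"
  then have "\<zeta> ^ (a * (n div a) + n mod a) = \<zeta> ^ (n mod a)"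
    by (simp only: power_add power_mult power_one mult_1)
  then show ?thesis by simp
qed

text \<open>
  Two choices of roots differ by an \<open>a\<close>-th root of unity \<open>\<zeta>\<close> and a \<open>b\<close>-th root of unity
  \<open>\<xi>\<close>, where \<open>a\<close> and \<open>b\<close> are the weights of index 0. The two values are the same point when
  \<open>t\<^sup>b = \<zeta>\<close> and \<open>t\<^sup>a = \<xi>\<close> have a common solution \<open>t\<close>, which exists because \<open>b\<close> is invertible
  modulo \<open>a\<close> and \<open>a\<close> is invertible modulo \<open>b\<close>.
\<close>

lemma twist_vec_roots_coprime:
  assumes cop: "coprime (w None) (v None)"
    and roots: "s ^ w None = s' ^ w None" "r ^ v None = r' ^ v None" and nz: "s \<noteq> 0" "r \<noteq> 0"
    and pos: "w None > 0" "v None > 0"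
  shows "wpoint (twist_weights w v) (twist_vec w v x y s' r') =
    wpoint (twist_weights w v) (twist_vec w v x y s r)"
proof -
  define \<zeta> where "\<zeta> = s' / s"
  define \<xi> where "\<xi> = r' / r"
  have nz': "s' ^ w None \<noteq> 0" "r' ^ v None \<noteq> 0"
    using roots[symmetric] nz by simp_all
  have unit: "\<zeta> ^ w None = 1" "\<xi> ^ v None = 1"
    using roots nz' by (simp_all add: \<zeta>_def \<xi>_def power_divide)
  obtain c where c: "[v None * c = 1] (mod w None)"
    using cong_solve_coprime_nat[of "v None" "w None"] cop by (auto simp: coprime_commute)
  obtain d where d: "[w None * d = 1] (mod v None)"
    using cong_solve_coprime_nat[of "w None" "v None"] cop by auto
  define t where "t = \<zeta> ^ c * \<xi> ^ d"
  have 1: "\<zeta> ^ (v None * c) = \<zeta>"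
    using c power_mod_root_of_unity[OF unit(1), of "v None * c"] power_mod_root_of_unity[OF unit(1), of 1]
    by (simp add: cong_def)
  have 2: "\<xi> ^ (w None * d) = \<xi>"
    using d power_mod_root_of_unity[OF unit(2), of "w None * d"] power_mod_root_of_unity[OF unit(2), of 1]
    by (simp add: cong_def)
  have "t ^ v None = \<zeta> ^ (v None * c) * (\<xi> ^ v None) ^ d"
    "t ^ w None = (\<zeta> ^ w None) ^ c * \<xi> ^ (w None * d)"
    by (simp_all add: t_def power_mult_distrib power_mult[symmetric] mult.commute)
  then have t: "t ^ v None = \<zeta>" "t ^ w None = \<xi>"
    using 1 2 unit by simp_all
  have "t \<noteq> 0" using t(1) unit(1) pos by (auto simp: zero_power)
  have "s' = t ^ v None * s" "r' = t ^ w None * r"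
    using t nz by (auto simp: \<zeta>_def \<xi>_def)
  then have "twist_vec w v x y s' r' = wscale (twist_weights w v) t (twist_vec w v x y s r)"
    by (auto simp: twist_vec_def wscale_def twist_weights_def fun_eq_iff power_mult_distrib
      power_mult[symmetric] mult_ac split: sum.split)
  with \<open>t \<noteq> 0\<close> show ?thesis by (simp add: wpoint_wscale)
qed

section \<open>Pullback of homogeneous polynomials along the twist map\<close>

text \<open>
  The exponent of \<open>s\<close> that a monomial acquires when the twisted vector is substituted;
  \<open>right_degree\<close> is the corresponding exponent of \<open>r\<close>.
\<close>

definition left_degree :: "('n::finite option \<Rightarrow> nat) \<Rightarrow> ('n + 'm \<Rightarrow>\<^sub>0 nat) \<Rightarrow> nat" where
  "left_degree w m = (\<Sum>i\<in>UNIV. w (Some i) * Poly_Mapping.lookup m (Inl i))"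

definition right_degree :: "('m::finite option \<Rightarrow> nat) \<Rightarrow> ('n + 'm \<Rightarrow>\<^sub>0 nat) \<Rightarrow> nat" where
  "right_degree v m = (\<Sum>j\<in>UNIV. v (Some j) * Poly_Mapping.lookup m (Inr j))"

lemma whomog_twist_weights_iff:
  "whomog (twist_weights w v) d g \<longleftrightarrow>
     (\<forall>m\<in>Poly_Mapping.keys g. v None * left_degree w m + w None * right_degree v m = d)"
  by (simp add: whomog_def sum_UNIV_sum twist_weights_def left_degree_def right_degree_def
      sum_distrib_left mult.assoc)

lemma peval_twist_vec:
  "peval g (twist_vec w v x y s r) =
     (\<Sum>m\<in>Poly_Mapping.keys g. Poly_Mapping.lookup g m *
        (s ^ left_degree w m * r ^ right_degree v m *
         ((\<Prod>i\<in>UNIV. x (Some i) ^ Poly_Mapping.lookup m (Inl i)) *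
          (\<Prod>j\<in>UNIV. y (Some j) ^ Poly_Mapping.lookup m (Inr j)))))"
  by (simp add: peval_def prod_UNIV_sum twist_vec_def power_mult_distrib prod.distrib
      power_mult[symmetric] power_sum[symmetric] left_degree_def right_degree_def mult_ac)

definition root_pullback ::
  "('n::finite option \<Rightarrow> nat) \<Rightarrow> ('m::finite option \<Rightarrow> nat) \<Rightarrow> ('n + 'm) cpoly \<Rightarrow>
   ('n option + 'm option) cpoly" where
  "root_pullback w v = map_exponents (\<lambda>m. case_sum
     (case_option (right_degree v m) (\<lambda>i. Poly_Mapping.lookup m (Inl i)))
     (case_option (left_degree w m) (\<lambda>j. Poly_Mapping.lookup m (Inr j))))"

lemma peval_root_pullback:
  "peval (root_pullback w v g) (case_sum x y) = peval g (twist_vec w v x y (y None) (x None))"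
  by (simp add: root_pullback_def peval_map_exponents peval_twist_vec prod_UNIV_sum
      prod_UNIV_option mult_ac)

lemma homog_root_pullback:
  assumes "whomog (twist_weights w v) d g"
  shows "homog (wproj_prod (root_weights (v None) w) (root_weights (w None) v)) (d, d)
    (root_pullback w v g)"
  using assms unfolding whomog_twist_weights_iff
  by (auto simp: root_pullback_def sum_UNIV_sum sum_UNIV_option root_weights_def
      left_degree_def right_degree_def sum_distrib_left mult.assoc intro!: whomog_map_exponents)

text \<open>
  Let \<open>L\<close> and \<open>R\<close> be the left and right degrees and \<open>b L + a R = d\<close>. As \<open>b\<close> is invertible modulo \<open>a\<close>,
  the residue of \<open>L\<close> modulo \<open>a\<close> depends on \<open>d\<close> only. Replacing \<open>a\<close> units of \<open>L\<close> by \<open>b\<close> units of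
  \<open>R\<close> keeps the sum, so moving the whole quotient \<open>L div a\<close> leads to the same pair \<open>(A, B)\<close> for all monomials.
\<close>

lemma coprime_twist_degrees:
  fixes w :: "'n::finite option \<Rightarrow> nat" and v :: "'m::finite option \<Rightarrow> nat"
  assumes cop: "coprime (w None) (v None)" and pos: "w None > 0" "v None > 0"
  obtains A B where "\<forall>m. v None * left_degree w m + w None * right_degree v m = d \<longrightarrow>
      left_degree w m mod w None = A \<and>
      right_degree v m + v None * (left_degree w m div w None) = B \<and>
      left_degree w m div w None \<le> d"
proof -
  obtain u where u: "[v None * u = 1] (mod w None)"
    using cong_solve_coprime_nat[of "v None" "w None"] cop by (auto simp: coprime_commute)
  show ?thesis
  proof (rule that[of "(u * d) mod w None" "(d - v None * ((u * d) mod w None)) div w None"], intro allI impI)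
    fix m :: "'n + 'm \<Rightarrow>\<^sub>0 nat"
    let ?L = "left_degree w m" and ?R = "right_degree v m"
    assume d: "v None * ?L + w None * ?R = d"
    have "[u * d = (v None * u) * ?L] (mod w None)"
      unfolding d[symmetric]
      by (simp add: cong_def algebra_simps)
        (metis mod_mult_self2 mult.assoc mult.commute mult.left_commute)
    also have "[(v None * u) * ?L = 1 * ?L] (mod w None)"
      using u by (intro cong_mult) auto
    finally have A: "?L mod w None = (u * d) mod w None" by (simp add: cong_def)
    have "d = v None * (?L mod w None) + w None * (?R + v None * (?L div w None))"
    proof -
      have "?L = ?L mod w None + w None * (?L div w None)" by simp
      then have "v None * ?L = v None * (?L mod w None) + w None * (v None * (?L div w None))"
        by (metis distrib_left mult.left_commute)
      with d show ?thesis by (simp add: distrib_left)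
    qed
    then have B: "?R + v None * (?L div w None) = (d - v None * ((u * d) mod w None)) div w None"
      using pos(1) unfolding A[symmetric] by (metis add_diff_cancel_left' nonzero_mult_div_cancel_left not_gr0)
    have "?L div w None \<le> ?L" by simp
    also have "?L \<le> v None * ?L" using pos by simp
    also have "\<dots> \<le> d" using d by linarith
    finally show "?L mod w None = (u * d) mod w None \<and>
      ?R + v None * (?L div w None) = (d - v None * ((u * d) mod w None)) div w None \<and>
      ?L div w None \<le> d"
      using A B by blast
  qed
qed

text \<open>
  With \<open>k = L div w\<^sub>0\<close>, a monomial with left degree \<open>L\<close> contributes \<open>s\<^sup>L r\<^sup>R = s\<^sup>A r\<^sup>B (y\<^sub>0 / x\<^sub>0)\<^sup>k\<close>,
  in the notation of the preceding lemma. Multiplication by \<open>x\<^sub>0\<^sup>d\<close>, the same for all monomials, clears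
  the denominators since \<open>k \<le> d\<close>.
\<close>

definition coprime_pullback ::
  "('n::finite option \<Rightarrow> nat) \<Rightarrow> nat \<Rightarrow> ('n + 'm::finite) cpoly \<Rightarrow>
   ('n option + 'm option) cpoly" where
  "coprime_pullback w d = map_exponents (\<lambda>m. case_sum
     (case_option (d - left_degree w m div w None) (\<lambda>i. Poly_Mapping.lookup m (Inl i)))
     (case_option (left_degree w m div w None) (\<lambda>j. Poly_Mapping.lookup m (Inr j))))"

text \<open>
  The common factor \<open>s\<^sup>A r\<^sup>B / x\<^sub>0\<^sup>d\<close> is independent of the polynomial, as \<open>morphismI\<close> demands.
\<close>

lemma coprime_pullback:
  fixes w :: "'n::finite option \<Rightarrow> nat" and v :: "'m::finite option \<Rightarrow> nat"
  assumes cop: "coprime (w None) (v None)" and pos: "w None > 0" "v None > 0"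
  obtains A B where
    "\<And>g. whomog (twist_weights w v) d g \<Longrightarrow>
      homog (wproj_prod w v) (w None * d + A, B) (coprime_pullback w d g)"
    "\<And>g x y s r. whomog (twist_weights w v) d g \<Longrightarrow> s ^ w None = y None \<Longrightarrow> r ^ v None = x None \<Longrightarrow>
      x None ^ d * peval g (twist_vec w v x y s r) =
        s ^ A * r ^ B * peval (coprime_pullback w d g) (case_sum x y)"
proof -
  obtain A B where AB: "\<forall>m. v None * left_degree w m + w None * right_degree v m = d \<longrightarrow>
      left_degree w m mod w None = A \<and>
      right_degree v m + v None * (left_degree w m div w None) = B \<and>
      left_degree w m div w None \<le> d"
    by (rule coprime_twist_degrees[where w = w and v = v and d = d, OF assms])
  show ?thesis
  proof (rule that[of A B])
    fix g :: "('n + 'm) cpoly"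
    assume g: "whomog (twist_weights w v) d g"
    have m: "w None * (d - left_degree w m div w None) + left_degree w m = w None * d + A"
      "v None * (left_degree w m div w None) + right_degree v m = B"
      "left_degree w m mod w None = A" "left_degree w m div w None \<le> d"
      if "m \<in> Poly_Mapping.keys g" for m
    proof -
      let ?L = "left_degree w m"
      have "?L mod w None = A" "right_degree v m + v None * (?L div w None) = B"
        and le: "?L div w None \<le> d"
        using AB g that unfolding whomog_twist_weights_iff by blast+
      then show "v None * (?L div w None) + right_degree v m = B" "?L mod w None = A"
        "?L div w None \<le> d" by simp_all
      have "?L = w None * (?L div w None) + A"
        using \<open>?L mod w None = A\<close> by (metis mult_div_mod_eq)
      moreover have "w None * (d - ?L div w None) + w None * (?L div w None) = w None * d"
        using le by (simp add: distrib_left[symmetric])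
      ultimately show "w None * (d - ?L div w None) + ?L = w None * d + A"
        by linarith
    qed
    show "homog (wproj_prod w v) (w None * d + A, B) (coprime_pullback w d g)"
      using m(1,2) by (auto simp: coprime_pullback_def sum_UNIV_sum sum_UNIV_option
          left_degree_def right_degree_def intro!: whomog_map_exponents)
    fix x :: "'n option \<Rightarrow> complex" and y :: "'m option \<Rightarrow> complex" and s r :: complex
    assume s: "s ^ w None = y None" and r: "r ^ v None = x None"
    have "x None ^ d * (s ^ left_degree w m * r ^ right_degree v m) =
        s ^ A * r ^ B * (x None ^ (d - left_degree w m div w None) *
          y None ^ (left_degree w m div w None))"
      if "m \<in> Poly_Mapping.keys g" for m
    proof -
      let ?k = "left_degree w m div w None"
      have "s ^ left_degree w m = s ^ A * y None ^ ?k"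
        using m(3)[OF that] unfolding s[symmetric] power_mult[symmetric] power_add[symmetric]
        by (metis mod_mult_div_eq)
      moreover have "x None ^ d = x None ^ (d - ?k) * x None ^ ?k"
        using m(4)[OF that] by (simp add: power_add[symmetric])
      moreover have "r ^ B = x None ^ ?k * r ^ right_degree v m"
        unfolding m(2)[OF that, symmetric] r[symmetric] by (simp add: power_add power_mult)
      ultimately show ?thesis by (simp add: mult_ac)
    qed
    then show "x None ^ d * peval g (twist_vec w v x y s r) =
        s ^ A * r ^ B * peval (coprime_pullback w d g) (case_sum x y)"
      unfolding peval_twist_vec coprime_pullback_def peval_map_exponents sum_distrib_left
      by (intro sum.cong refl) (simp add: prod_UNIV_sum prod_UNIV_option mult_ac)
  qed
qed

section \<open>The hypersurfaces in terms of coordinates\<close>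

lemma peval_wscale_Some:
  assumes "whomog (\<lambda>i. w (Some i)) d f"
  shows "peval f (\<lambda>i. wscale w t x (Some i)) = t ^ d * peval f (\<lambda>i. x (Some i))"
  using peval_wscale[OF assms, of t "\<lambda>i. x (Some i)"] by (simp add: wscale_def)

lemma cyclic_hypersurface_iff:
  assumes p: "whomog (\<lambda>i. w (Some i)) (l * w None) p"
  shows "wpoint w x \<in> cyclic_hypersurface w l p \<longleftrightarrow>
    x \<noteq> (\<lambda>_. 0) \<and> x None ^ l + peval p (\<lambda>i. x (Some i)) = 0"
proof -
  have scale: "wscale w t x None ^ l + peval p (\<lambda>i. wscale w t x (Some i)) =
      t ^ (l * w None) * (x None ^ l + peval p (\<lambda>i. x (Some i)))" for t
    unfolding peval_wscale_Some[OF p]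
    by (simp add: wscale_def power_mult_distrib power_mult[symmetric] mult.commute distrib_left)
  have "(\<forall>z\<in>wpoint w x. z None ^ l + peval p (\<lambda>i. z (Some i)) = 0) \<longleftrightarrow>
      x None ^ l + peval p (\<lambda>i. x (Some i)) = 0"
  proof
    assume "\<forall>z\<in>wpoint w x. z None ^ l + peval p (\<lambda>i. z (Some i)) = 0"
    then show "x None ^ l + peval p (\<lambda>i. x (Some i)) = 0" by simp
  next
    assume "x None ^ l + peval p (\<lambda>i. x (Some i)) = 0"
    with scale show "\<forall>z\<in>wpoint w x. z None ^ l + peval p (\<lambda>i. z (Some i)) = 0"
      unfolding wpoint_eq_wscale by auto
  qed
  then show ?thesis
    by (simp add: cyclic_hypersurface_def wpoint_in_points_iff)
qed

lemma peval_wscale_twist: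
  assumes "whomog (\<lambda>i. w (Some i)) (l * w None) p" "whomog (\<lambda>j. v (Some j)) (l * v None) q"
  shows "peval p (\<lambda>i. wscale (twist_weights w v) t z (Inl i)) =
      t ^ (l * w None * v None) * peval p (\<lambda>i. z (Inl i))"
    and "peval q (\<lambda>j. wscale (twist_weights w v) t z (Inr j)) =
      t ^ (l * w None * v None) * peval q (\<lambda>j. z (Inr j))"
  using peval_wscale[OF assms(1), of "t ^ v None" "\<lambda>i. z (Inl i)"]
    peval_wscale[OF assms(2), of "t ^ w None" "\<lambda>j. z (Inr j)"]
  by (simp_all add: wscale_def twist_weights_def power_mult[symmetric] mult_ac)

lemma difference_hypersurface_iff:
  assumes "whomog (\<lambda>i. w (Some i)) (l * w None) p" "whomog (\<lambda>j. v (Some j)) (l * v None) q"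
  shows "wpoint (twist_weights w v) z \<in> difference_hypersurface (twist_weights w v) p q \<longleftrightarrow>
    z \<noteq> (\<lambda>_. 0) \<and> peval p (\<lambda>i. z (Inl i)) = peval q (\<lambda>j. z (Inr j))"
proof -
  have "(\<forall>y\<in>wpoint (twist_weights w v) z. peval p (\<lambda>i. y (Inl i)) - peval q (\<lambda>j. y (Inr j)) = 0)
      \<longleftrightarrow> peval p (\<lambda>i. z (Inl i)) = peval q (\<lambda>j. z (Inr j))" (is "?L \<longleftrightarrow> ?R")
  proof
    assume ?L
    then have "peval p (\<lambda>i. z (Inl i)) - peval q (\<lambda>j. z (Inr j)) = 0" by simp
    then show ?R by simp
  next
    assume ?R
    with peval_wscale_twist[OF assms] show ?L
      unfolding wpoint_eq_wscale by auto
  qed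
  then show ?thesis
    by (simp add: difference_hypersurface_def wpoint_in_points_iff)
qed

lemma peval_twist_vec_parts:
  assumes "whomog (\<lambda>i. w (Some i)) (l * w None) p" "whomog (\<lambda>j. v (Some j)) (l * v None) q"
    and "s ^ w None = y None" "r ^ v None = x None"
  shows "peval p (\<lambda>i. twist_vec w v x y s r (Inl i)) = y None ^ l * peval p (\<lambda>i. x (Some i))"
    and "peval q (\<lambda>j. twist_vec w v x y s r (Inr j)) = x None ^ l * peval q (\<lambda>j. y (Some j))"
proof -
  have "s ^ (l * w None) = y None ^ l" "r ^ (l * v None) = x None ^ l"
    unfolding assms(3,4)[symmetric] by (simp_all add: power_mult[symmetric] mult.commute)
  then show "peval p (\<lambda>i. twist_vec w v x y s r (Inl i)) = y None ^ l * peval p (\<lambda>i. x (Some i))"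
    "peval q (\<lambda>j. twist_vec w v x y s r (Inr j)) = x None ^ l * peval q (\<lambda>j. y (Some j))"
    using peval_wscale[OF assms(1), of s "\<lambda>i. x (Some i)"]
      peval_wscale[OF assms(2), of r "\<lambda>j. y (Some j)"]
    by (simp_all add: wscale_def twist_vec_def)
qed

section \<open>Root covers\<close>

lemma root_points_iff:
  assumes k: "k > 0" and P: "P \<in> points (wproj w)"
  shows "wpoint (root_weights k w) z \<in> root_points k w P \<longleftrightarrow> z(None := z None ^ k) \<in> P"
proof
  assume "wpoint (root_weights k w) z \<in> root_points k w P"
  then show "z(None := z None ^ k) \<in> P" by (auto simp: root_points_def)
next
  assume z: "z(None := z None ^ k) \<in> P"
  then have P': "P = wpoint w (z(None := z None ^ k))" "z(None := z None ^ k) \<noteq> (\<lambda>_. 0)"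
    using point_eq_wpoint[OF P] by blast+
  have "z \<noteq> (\<lambda>_. 0)"
  proof
    assume "z = (\<lambda>_. 0)"
    with P'(2) k show False by (simp add: fun_eq_iff zero_power)
  qed
  then have nz: "wpoint (root_weights k w) z \<in> points (wproj (root_weights k w))"
    by (simp add: wpoint_in_points_iff)
  have "(wscale (root_weights k w) t z)(None := wscale (root_weights k w) t z None ^ k) \<in> P"
    if "t \<noteq> 0" for t
  proof -
    have "(wscale (root_weights k w) t z)(None := wscale (root_weights k w) t z None ^ k) =
        wscale w (t ^ k) (z(None := z None ^ k))"
      by (auto simp: fun_eq_iff wscale_def root_weights_def power_mult_distrib
          power_mult[symmetric] mult.commute split: option.split)
    moreover have "t ^ k \<noteq> 0" using that by simp
    ultimately show ?thesis unfolding P'(1) wpoint_eq_wscale by blast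
  qed
  then have "\<forall>z'\<in>wpoint (root_weights k w) z. z'(None := z' None ^ k) \<in> P"
    unfolding wpoint_eq_wscale by blast
  with nz show "wpoint (root_weights k w) z \<in> root_points k w P"
    unfolding root_points_def by simp
qed

lemma root_pointsD:
  assumes "P' \<in> root_points k w P" "z \<in> P'"
  shows "P' = wpoint (root_weights k w) z" "z(None := z None ^ k) \<in> P"
  using assms point_eq_wpoint(1)[of P' "root_weights k w" z] by (auto simp: root_points_def)

lemma twist_vec_upd [simp]:
  "twist_vec w v (x(None := a)) y s r = twist_vec w v x y s r"
  "twist_vec w v x (y(None := b)) s r = twist_vec w v x y s r"
  by (simp_all add: twist_vec_def)

text \<open>
  On the root covers the coordinates \<open>x\<^sub>0\<close> and \<open>y\<^sub>0\<close> are themselves the chosen roots \<open>r\<close> and \<open>s\<close>. The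
  choice of representatives is immaterial on points of the covers, by the next lemma.
\<close>

definition root_twist ::
  "('n option \<Rightarrow> nat) \<Rightarrow> ('m option \<Rightarrow> nat) \<Rightarrow>
   'n option wpoint \<times> 'm option wpoint \<Rightarrow> ('n + 'm) wpoint" where
  "root_twist w v = (\<lambda>(P, Q). wpoint (twist_weights w v)
     (let x = SOME x. x \<in> P; y = SOME y. y \<in> Q in twist_vec w v x y (y None) (x None)))"

lemma root_twist_eq:
  "root_twist w v (wpoint (root_weights (v None) w) x, wpoint (root_weights (w None) v) y) =
     wpoint (twist_weights w v) (twist_vec w v x y (y None) (x None))"
proof -
  define x' where "x' = (SOME x'. x' \<in> wpoint (root_weights (v None) w) x)"
  define y' where "y' = (SOME y'. y' \<in> wpoint (root_weights (w None) v) y)"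
  have "x' \<in> wpoint (root_weights (v None) w) x" "y' \<in> wpoint (root_weights (w None) v) y"
    unfolding x'_def y'_def by (rule someI[of _ x], simp, rule someI[of _ y], simp)
  then obtain t u where "t \<noteq> 0" "x' = wscale (root_weights (v None) w) t x"
    "u \<noteq> 0" "y' = wscale (root_weights (w None) v) u y"
    by (auto simp: wpoint_eq_wscale)
  then have "twist_vec w v x' y' (y' None) (x' None) =
      wscale (twist_weights w v) (t * u) (twist_vec w v x y (y None) (x None))" "t * u \<noteq> 0"
    by (auto simp: twist_vec_def wscale_def twist_weights_def root_weights_def fun_eq_iff
        power_mult_distrib power_mult[symmetric] mult_ac split: sum.split)
  then show ?thesis
    unfolding root_twist_def by (simp add: Let_def x'_def[symmetric] y'_def[symmetric] wpoint_wscale)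
qed

section \<open>Dense open sets, image and fibres\<close>

text \<open>
  The pairs away from the branch loci \<open>x\<^sub>0 = 0\<close> and \<open>y\<^sub>0 = 0\<close> of the two root covers.
\<close>

definition nonbranch ::
  "'n option wpoint set \<Rightarrow> 'm option wpoint set \<Rightarrow> ('n option wpoint \<times> 'm option wpoint) set" where
  "nonbranch V1 V2 = {(P, Q). P \<in> V1 \<and> Q \<in> V2 \<and> (\<forall>x\<in>P. x None \<noteq> 0) \<and> (\<forall>y\<in>Q. y None \<noteq> 0)}"

lemma wpoint_None_nonzero_iff:
  "(\<forall>z\<in>wpoint w x. z None \<noteq> 0) \<longleftrightarrow> x None \<noteq> 0"
proof
  assume "x None \<noteq> 0"
  then show "\<forall>z\<in>wpoint w x. z None \<noteq> 0" by (auto simp: wpoint_eq_wscale wscale_def)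
qed simp

lemma nonbranchE:
  assumes "(P, Q) \<in> nonbranch V1 V2" "V1 \<subseteq> points (wproj w)" "V2 \<subseteq> points (wproj v)"
  obtains x y where "P = wpoint w x" "Q = wpoint v y" "x None \<noteq> 0" "y None \<noteq> 0"
    "wpoint w x \<in> V1" "wpoint v y \<in> V2"
proof -
  from assms have "P \<in> points (wproj w)" "Q \<in> points (wproj v)"
    by (auto simp: nonbranch_def)
  then obtain x y where "P = wpoint w x" "Q = wpoint v y"
    by (auto simp: points_wproj)
  with assms(1) show ?thesis
    using that[of x y] by (auto simp: nonbranch_def)
qed

text \<open>
  For a quasi-smooth polynomial the nonvanishing at some vector is \<open>quasi_smooth_nonzero\<close>; it makes the
  perturbation lemmas applicable.
\<close>

locale cyclic_pair =
  fixes w :: "'n::finite option \<Rightarrow> nat" and v :: "'m::finite option \<Rightarrow> nat"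
    and l :: nat and p :: "'n cpoly" and q :: "'m cpoly"
  assumes w_pos: "w None > 0" and v_pos: "v None > 0" and l_pos: "l > 0"
    and p: "whomog (\<lambda>i. w (Some i)) (l * w None) p"
    and q: "whomog (\<lambda>j. v (Some j)) (l * v None) q"
    and p_nonzero: "\<exists>z. peval p z \<noteq> 0" and q_nonzero: "\<exists>z. peval q z \<noteq> 0"
begin

abbreviation "tw \<equiv> twist_weights w v"
abbreviation "V1 \<equiv> cyclic_hypersurface w l p"
abbreviation "V2 \<equiv> cyclic_hypersurface v l q"
abbreviation "X \<equiv> difference_hypersurface (twist_weights w v) p q"
abbreviation "U \<equiv> nonbranch V1 V2"

lemma V1_points: "V1 \<subseteq> points (wproj w)" and V2_points: "V2 \<subseteq> points (wproj v)"
  and X_points: "X \<subseteq> points (wproj tw)"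
  by (auto simp: cyclic_hypersurface_def difference_hypersurface_def)

lemma p_at_zero: "peval p (\<lambda>_. 0) = 0"
  using peval_at_zero[OF p] l_pos w_pos by simp

text \<open>
  Both sides of the equation of \<open>X\<close> become \<open>- x\<^sub>0\<^sup>l y\<^sub>0\<^sup>l\<close>, and this is nonzero, so the value is not
  the zero vector.
\<close>

lemma twist_value_in_X:
  assumes "wpoint w x \<in> V1" "wpoint v y \<in> V2" "x None \<noteq> 0" "y None \<noteq> 0"
    and "s ^ w None = y None" "r ^ v None = x None"
  shows "twist_vec w v x y s r \<noteq> (\<lambda>_. 0)" "wpoint tw (twist_vec w v x y s r) \<in> X"
proof -
  have eqs: "peval p (\<lambda>i. x (Some i)) = - (x None ^ l)" "peval q (\<lambda>j. y (Some j)) = - (y None ^ l)"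
    using assms(1,2) unfolding cyclic_hypersurface_iff[OF p] cyclic_hypersurface_iff[OF q]
    by (simp_all add: add_eq_0_iff)
  note parts = peval_twist_vec_parts[where w = w and v = v and x = x and y = y, OF p q assms(5,6)]
  have "peval p (\<lambda>i. twist_vec w v x y s r (Inl i)) \<noteq> 0"
    unfolding parts eqs using assms(3,4) by simp
  then show nz: "twist_vec w v x y s r \<noteq> (\<lambda>_. 0)" using p_at_zero by auto
  show "wpoint tw (twist_vec w v x y s r) \<in> X"
    unfolding difference_hypersurface_iff[OF p q] using nz unfolding parts eqs by simp
qed

lemma twist_map_U:
  assumes "PQ \<in> U"
  shows "twist_map w v PQ \<noteq> {}" "finite (twist_map w v PQ)" "twist_map w v PQ \<subseteq> X"
proof -
  obtain P Q where PQ: "PQ = (P, Q)" by (cases PQ)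
  obtain x y where x: "P = wpoint w x" "wpoint w x \<in> V1" "x None \<noteq> 0"
    and y: "Q = wpoint v y" "wpoint v y \<in> V2" "y None \<noteq> 0"
    by (rule nonbranchE[OF assms[unfolded PQ] V1_points V2_points])
  note val = twist_value_in_X[OF x(2) y(2) x(3) y(3)]
  obtain s r where "s ^ w None = y None" "r ^ v None = x None"
    using complex_root_exists w_pos v_pos by metis
  then have "wpoint tw (twist_vec w v x y s r) \<in> twist_map w v PQ"
    unfolding PQ x(1) y(1) by (intro in_twist_mapI val(1)) simp_all
  then show "twist_map w v PQ \<noteq> {}" by blast
  show "finite (twist_map w v PQ)"
    unfolding PQ x(1) y(1) by (rule finite_twist_map[where w = w and v = v, OF w_pos v_pos])
  show "twist_map w v PQ \<subseteq> X"
  proof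
    fix R assume "R \<in> twist_map w v PQ"
    then show "R \<in> X"
      unfolding PQ x(1) y(1)
      by (rule twist_map_fixed_coords[where w = w and v = v, OF w_pos v_pos]) (simp add: val)
  qed
qed

text \<open>
  Density: a pair in \<open>V1 \<times> V2\<close> is moved in each factor separately, by \<open>cyclic_cone_perturb\<close>.
\<close>

lemma dense_open_U: "dense_open (subtopology (zariski (wproj_prod w v)) (V1 \<times> V2)) U"
proof -
  let ?S = "wproj_prod w v"
  \<comment> \<open>The locus is cut out by the bihomogeneous monomial that is the product of the two coordinates of index 0.\<close>
  let ?m = "Abs_poly_mapping (case_sum (case_option 1 (\<lambda>_. 0)) (case_option 1 (\<lambda>_. 0)))
    :: 'n option + 'm option \<Rightarrow>\<^sub>0 nat"
  let ?f = "Poly_Mapping.single ?m (1 :: complex)"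
  have ev: "peval ?f (case_sum x y) = x None * y None" for x y
    by (simp add: peval_single prod_UNIV_sum prod_UNIV_option)
  have "homog ?S (w None, v None) ?f"
    by (simp add: whomog_def sum_UNIV_sum sum_UNIV_option)
  from openin_zariski_nonvanishing[OF this]
  have op: "openin (zariski ?S) {P \<in> points ?S. \<forall>x\<in>coords ?S P. peval ?f x \<noteq> 0}" .
  have U_eq: "U = {P \<in> points ?S. \<forall>x\<in>coords ?S P. peval ?f x \<noteq> 0} \<inter> V1 \<times> V2"
  proof (intro set_eqI)
    fix PQ :: "'n option wpoint \<times> 'm option wpoint"
    obtain P Q where PQ: "PQ = (P, Q)" by (cases PQ)
    show "PQ \<in> U \<longleftrightarrow> PQ \<in> {P \<in> points ?S. \<forall>x\<in>coords ?S P. peval ?f x \<noteq> 0} \<inter> V1 \<times> V2"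
    proof (cases "P \<in> V1 \<and> Q \<in> V2")
      case True
      then have "P \<in> points (wproj w)" "Q \<in> points (wproj v)"
        using V1_points V2_points by blast+
      then obtain x y where xy: "P = wpoint w x" "Q = wpoint v y"
        by (auto simp: points_wproj)
      have "(\<forall>z\<in>coords ?S (P, Q). peval ?f z \<noteq> 0) \<longleftrightarrow>
          (\<forall>x\<in>P. x None \<noteq> 0) \<and> (\<forall>y\<in>Q. y None \<noteq> 0)" (is "?L \<longleftrightarrow> ?R")
      proof
        assume ?L
        then have "peval ?f (case_sum x y) \<noteq> 0"
          unfolding coords_wproj_prod xy using wpoint_self[of x w] wpoint_self[of y v] by blast
        then show ?R unfolding ev xy wpoint_None_nonzero_iff by simp
      next
        assume ?R
        show ?L
        proof
          fix z assume "z \<in> coords ?S (P, Q)"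
          then obtain x' y' where "z = case_sum x' y'" "x' \<in> P" "y' \<in> Q" by auto
          with \<open>?R\<close> show "peval ?f z \<noteq> 0" by (simp only: ev) simp
        qed
      qed
      then show ?thesis
        using True V1_points V2_points unfolding PQ nonbranch_def mem_Collect_eq Int_iff
        by (simp only: points_wproj_prod mem_Sigma_iff prod.case) blast
    qed (auto simp: PQ nonbranch_def)
  qed
  have open_U: "openin (subtopology (zariski ?S) (V1 \<times> V2)) U"
    unfolding U_eq openin_subtopology using op by blast
  have top: "topspace (subtopology (zariski ?S) (V1 \<times> V2)) = V1 \<times> V2"
    using V1_points V2_points by auto
  have "subtopology (zariski ?S) (V1 \<times> V2) closure_of U =
      topspace (subtopology (zariski ?S) (V1 \<times> V2))"
    unfolding dense_intersects_open
  proof (intro allI impI, elim conjE)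
    fix T assume "openin (subtopology (zariski ?S) (V1 \<times> V2)) T" "T \<noteq> {}"
    then obtain N P Q where N: "openin (zariski ?S) N" "T = N \<inter> V1 \<times> V2" "(P, Q) \<in> T"
      by (auto simp: openin_subtopology)
    then have P: "P \<in> V1" "Q \<in> V2" "(P, Q) \<in> N" by auto
    have "P \<in> points (wproj w)" "Q \<in> points (wproj v)"
      using P V1_points V2_points by blast+
    then obtain x y where xy: "P = wpoint w x" "Q = wpoint v y"
      by (auto simp: points_wproj)
    have "case_sum x y \<in> coords ?S (P, Q)"
      unfolding xy coords_wproj_prod using wpoint_self[of x w] wpoint_self[of y v] by blast
    from zariski_open_classical_nhd[OF homogeneous_coords_wproj_prod N(1) P(3) this]
    obtain A where A: "open A" "case_sum x y \<in> A"
      and AN: "\<And>Q y. Q \<in> points ?S \<Longrightarrow> y \<in> coords ?S Q \<Longrightarrow> y \<in> A \<Longrightarrow> Q \<in> N" by blast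
    obtain B C where B: "open B" "x \<in> B" and C: "open C" "y \<in> C"
      and BC: "\<And>x' y'. x' \<in> B \<Longrightarrow> y' \<in> C \<Longrightarrow> case_sum x' y' \<in> A"
      using case_sum_nhds[OF A] by metis
    have x: "x None ^ l + peval p (\<lambda>i. x (Some i)) = 0"
      using P(1) unfolding xy cyclic_hypersurface_iff[OF p] by blast
    have y: "y None ^ l + peval q (\<lambda>i. y (Some i)) = 0"
      using P(2) unfolding xy cyclic_hypersurface_iff[OF q] by blast
    have l: "1 \<le> l" using l_pos by simp
    obtain x' where x': "x' \<in> B" "x' None \<noteq> 0" "x' None ^ l + peval p (\<lambda>i. x' (Some i)) = 0"
      using cyclic_cone_perturb[OF _ l x B] p_nonzero by blast
    obtain y' where y': "y' \<in> C" "y' None \<noteq> 0" "y' None ^ l + peval q (\<lambda>i. y' (Some i)) = 0"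
      using cyclic_cone_perturb[OF _ l y C] q_nonzero by blast
    have nz: "x' \<noteq> (\<lambda>_. 0)" "y' \<noteq> (\<lambda>_. 0)" using x'(2) y'(2) by auto
    have in_V: "wpoint w x' \<in> V1" "wpoint v y' \<in> V2"
      unfolding cyclic_hypersurface_iff[OF p] cyclic_hypersurface_iff[OF q] using x' y' nz by auto
    have "(wpoint w x', wpoint v y') \<in> U"
      unfolding nonbranch_def using in_V x'(2) y'(2) by (simp add: wpoint_None_nonzero_iff)
    moreover have "(wpoint w x', wpoint v y') \<in> N"
    proof (rule AN)
      show "(wpoint w x', wpoint v y') \<in> points ?S" using nz by (simp add: wpoint_in_points_iff)
      show "case_sum x' y' \<in> coords ?S (wpoint w x', wpoint v y')"
        unfolding coords_wproj_prod using wpoint_self[of x' w] wpoint_self[of y' v] by blast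
      show "case_sum x' y' \<in> A" using BC x' y' by blast
    qed
    ultimately show "U \<inter> T \<noteq> {}" using N(2) in_V by blast
  qed
  with open_U show ?thesis by (simp add: dense_open_def)
qed


text \<open>
  Since \<open>p(z) = - x\<^sub>0\<^sup>l y\<^sub>0\<^sup>l\<close> for a value of the twist map, this is the part of \<open>X\<close> whose preimages lie
  in \<open>U\<close>.
\<close>

definition nonbranch_X :: "('n + 'm) wpoint set" where
  "nonbranch_X = {R \<in> X. \<forall>z\<in>R. peval p (\<lambda>i. z (Inl i)) \<noteq> 0}"

lemma nonbranch_X_iff:
  "wpoint tw z \<in> nonbranch_X \<longleftrightarrow>
     peval p (\<lambda>i. z (Inl i)) = peval q (\<lambda>j. z (Inr j)) \<and> peval p (\<lambda>i. z (Inl i)) \<noteq> 0"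
proof -
  have "(\<forall>y\<in>wpoint tw z. peval p (\<lambda>i. y (Inl i)) \<noteq> 0) \<longleftrightarrow> peval p (\<lambda>i. z (Inl i)) \<noteq> 0"
  proof
    assume "\<forall>y\<in>wpoint tw z. peval p (\<lambda>i. y (Inl i)) \<noteq> 0"
    then show "peval p (\<lambda>i. z (Inl i)) \<noteq> 0" by simp
  next
    assume "peval p (\<lambda>i. z (Inl i)) \<noteq> 0"
    then show "\<forall>y\<in>wpoint tw z. peval p (\<lambda>i. y (Inl i)) \<noteq> 0"
      unfolding wpoint_eq_wscale by (auto simp: peval_wscale_twist[where w = w and v = v, OF p q])
  qed
  moreover have "z \<noteq> (\<lambda>_. 0)" if "peval p (\<lambda>i. z (Inl i)) \<noteq> 0"
    using that p_at_zero by auto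
  ultimately show ?thesis
    unfolding nonbranch_X_def mem_Collect_eq difference_hypersurface_iff[OF p q] by blast
qed

text \<open>
  The preimage is constructed with \<open>s = y\<^sub>0 = 1\<close>: the first block of coordinates is then \<open>z\<close> itself, the
  equation of \<open>V1\<close> forces \<open>r\<^sup>b\<^sup>l = - p(z)\<close>, and the equation of \<open>V2\<close> follows from \<open>p(z) = q(t)\<close>.
\<close>

lemma nonbranch_X_subset_image:
  assumes R: "R \<in> nonbranch_X"
  shows "R \<in> (\<Union>P\<in>U. twist_map w v P)"
proof -
  from R have "R \<in> points (wproj tw)" using X_points by (auto simp: nonbranch_X_def)
  then obtain z where z: "R = wpoint tw z" by (auto simp: points_wproj)
  let ?c = "peval p (\<lambda>i. z (Inl i))"
  have c: "?c = peval q (\<lambda>j. z (Inr j))" "?c \<noteq> 0"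
    using R unfolding z nonbranch_X_iff by blast+
  obtain r where r: "r ^ (v None * l) = - ?c"
    using complex_root_exists v_pos l_pos by (metis nat_0_less_mult_iff)
  have "r \<noteq> 0" using r c(2) v_pos l_pos by (auto simp: zero_power)
  define x where "x = case_option (r ^ v None) (\<lambda>i. z (Inl i))"
  define y where "y = case_option 1 (\<lambda>j. z (Inr j) / r ^ v (Some j))"
  have roots: "1 ^ w None = y None" "r ^ v None = x None" by (simp_all add: x_def y_def)
  have tv: "twist_vec w v x y 1 r = z"
    using \<open>r \<noteq> 0\<close> by (auto simp: twist_vec_def x_def y_def fun_eq_iff split: sum.split)
  have xl: "x None ^ l = - ?c" using r by (simp add: x_def power_mult)
  have "peval q (\<lambda>j. z (Inr j)) = x None ^ l * peval q (\<lambda>j. y (Some j))"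
    using peval_twist_vec_parts(2)[where w = w and v = v and x = x and y = y, OF p q roots]
    unfolding tv .
  then have qy: "peval q (\<lambda>j. y (Some j)) = - 1"
    using c unfolding xl by (metis add.inverse_inverse mult_minus_left mult_cancel_left2 mult_minus_right)
  have nz: "x None \<noteq> 0" "y None \<noteq> 0" using \<open>r \<noteq> 0\<close> by (simp_all add: x_def y_def)
  then have nz': "x \<noteq> (\<lambda>_. 0)" "y \<noteq> (\<lambda>_. 0)" by auto
  have "wpoint w x \<in> V1"
    unfolding cyclic_hypersurface_iff[OF p] xl using nz' by (simp add: x_def)
  moreover have "wpoint v y \<in> V2"
    unfolding cyclic_hypersurface_iff[OF q] qy using nz' by (simp add: y_def)
  ultimately have "(wpoint w x, wpoint v y) \<in> U"
    unfolding nonbranch_def using nz by (simp add: wpoint_None_nonzero_iff)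
  moreover have "wpoint tw (twist_vec w v x y 1 r) \<in> twist_map w v (wpoint w x, wpoint v y)"
  proof (rule in_twist_mapI[where w = w and v = v and x = x and y = y, OF wpoint_self wpoint_self roots])
    show "twist_vec w v x y 1 r \<noteq> (\<lambda>_. 0)" unfolding tv using c(2) p_at_zero by auto
  qed
  ultimately show ?thesis unfolding tv z by blast
qed

text \<open>
  Every preimage has coordinates of the form used in \<open>nonbranch_X_subset_image\<close>: two scaling
  parameters are available, one to achieve \<open>s = 1\<close>, the other to make the twisted vector equal to the given
  vector \<open>z\<close> and not only proportional to it. Only the finitely many \<open>r\<close> are left.
\<close>

lemma finite_fibre:
  assumes R: "R \<in> nonbranch_X"
  shows "finite {P \<in> V1 \<times> V2. R \<in> twist_map w v P}"
proof -
  from R have Rp: "R \<in> points (wproj tw)" using X_points by (auto simp: nonbranch_X_def)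
  then obtain z where z: "R = wpoint tw z" by (auto simp: points_wproj)
  let ?c = "peval p (\<lambda>i. z (Inl i))"
  define G where "G = (\<lambda>r. (wpoint w (case_option (r ^ v None) (\<lambda>i. z (Inl i))),
    wpoint v (case_option 1 (\<lambda>j. z (Inr j) / r ^ v (Some j)))))"
  have c: "?c \<noteq> 0"
    using R unfolding z nonbranch_X_iff by blast
  have "{P \<in> V1 \<times> V2. R \<in> twist_map w v P} \<subseteq> G ` {r. r ^ (v None * l) = - ?c}"
  proof
    fix PQ assume "PQ \<in> {P \<in> V1 \<times> V2. R \<in> twist_map w v P}"
    then obtain P Q where PQ: "PQ = (P, Q)" "P \<in> V1" "Q \<in> V2" "R \<in> twist_map w v (P, Q)"
      by auto
    then obtain x y s r where xy: "x \<in> P" "y \<in> Q" "s ^ w None = y None" "r ^ v None = x None"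
      and R': "R = wpoint tw (twist_vec w v x y s r)"
      unfolding in_twist_map_iff by blast
    have P: "P = wpoint w x" "Q = wpoint v y"
      using point_eq_wpoint(1) xy PQ V1_points V2_points by blast+
    have "z \<in> wpoint tw (twist_vec w v x y s r)" using z R' by (metis wpoint_self)
    then obtain \<tau> where \<tau>: "\<tau> \<noteq> 0" "z = wscale tw \<tau> (twist_vec w v x y s r)"
      by (auto simp: wpoint_eq_wscale)
    have "y None \<noteq> 0"
      using R l_pos unfolding R' nonbranch_X_iff
        peval_twist_vec_parts[where w = w and v = v and x = x and y = y, OF p q xy(3,4)]
      by (auto simp: zero_power)
    then have "s \<noteq> 0" using xy(3) w_pos by (auto simp: zero_power)
    \<comment> \<open>The parameter u normalizes s to 1, and t absorbs the remaining factor.\<close>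
    obtain u where u: "u ^ v None = 1 / s" using complex_root_exists v_pos by metis
    have "u \<noteq> 0" using u v_pos \<open>s \<noteq> 0\<close> by (auto simp: zero_power)
    define t where "t = \<tau> / u"
    have "t \<noteq> 0" using \<tau> \<open>u \<noteq> 0\<close> by (simp add: t_def)
    define x' where "x' = wscale w (t ^ v None) x"
    define y' where "y' = wscale v (u ^ w None) y"
    define r' where "r' = t ^ w None * r"
    have tv: "twist_vec w v x' y' 1 r' = z"
      using twist_vec_wscale[of w v t x u y s r] \<open>s \<noteq> 0\<close> \<open>u \<noteq> 0\<close> \<tau>(2)
      by (simp add: u x'_def y'_def r'_def t_def)
    have P': "P = wpoint w x'" "Q = wpoint v y'"
      unfolding P x'_def y'_def using \<open>t \<noteq> 0\<close> \<open>u \<noteq> 0\<close> by (simp_all add: wpoint_wscale)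
    have x'0: "x' None = r' ^ v None"
      unfolding x'_def r'_def wscale_def xy(4)[symmetric]
      by (simp add: power_mult_distrib power_mult[symmetric] mult.commute)
    have "y' None = (u ^ v None * s) ^ w None"
      unfolding y'_def wscale_def xy(3)[symmetric]
      by (simp add: power_mult_distrib power_mult[symmetric] mult.commute)
    then have y'0: "y' None = 1" using u \<open>s \<noteq> 0\<close> by simp
    have x'S: "x' (Some i) = z (Inl i)" for i
      unfolding tv[symmetric] by (simp add: twist_vec_def)
    have y'S: "r' ^ v (Some j) * y' (Some j) = z (Inr j)" for j
      unfolding tv[symmetric] by (simp add: twist_vec_def)
    \<comment> \<open>The equation of V1 now constrains only the root.\<close>
    have "x' None ^ l + ?c = 0"
      using PQ(2) unfolding P' cyclic_hypersurface_iff[OF p] x'S by blast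
    then have r': "r' ^ (v None * l) = - ?c"
      unfolding x'0 power_mult by (simp add: add_eq_0_iff)
    then have "r' \<noteq> 0" using c v_pos l_pos by (auto simp: zero_power)
    have "x' = case_option (r' ^ v None) (\<lambda>i. z (Inl i))"
      by (auto simp: fun_eq_iff x'0 x'S split: option.split)
    moreover have "y' = case_option 1 (\<lambda>j. z (Inr j) / r' ^ v (Some j))"
      using \<open>r' \<noteq> 0\<close> by (auto simp: fun_eq_iff y'0 y'S[symmetric] split: option.split)
    ultimately have "PQ = G r'" unfolding PQ P' G_def by simp
    with r' show "PQ \<in> G ` {r. r ^ (v None * l) = - ?c}" by blast
  qed
  moreover have "finite {r. r ^ (v None * l) = - ?c}"
    using v_pos l_pos by (intro finite_nth_roots) simp
  ultimately show ?thesis by (meson finite_imageI finite_subset)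
qed

lemma dense_open_nonbranch_X:
  "dense_open (subtopology (zariski (wproj tw)) X) nonbranch_X"
proof -
  let ?S = "wproj tw"
  let ?f = "map_exponents (\<lambda>m. case_sum (Poly_Mapping.lookup m) (\<lambda>_. 0)) p :: ('n + 'm) cpoly"
  have ev: "peval ?f z = peval p (\<lambda>i. z (Inl i))" for z
    by (simp add: peval_map_exponents prod_UNIV_sum peval_def[of p])
  have "homog ?S (v None * (l * w None)) ?f"
    unfolding homog_wproj using p
    by (intro whomog_map_exponents)
      (simp add: sum_UNIV_sum twist_weights_def whomog_def mult.assoc sum_distrib_left[symmetric])
  from openin_zariski_nonvanishing[OF this]
  have op: "openin (zariski ?S) {P \<in> points ?S. \<forall>x\<in>coords ?S P. peval ?f x \<noteq> 0}" .
  have eq: "nonbranch_X = {P \<in> points ?S. \<forall>x\<in>coords ?S P. peval ?f x \<noteq> 0} \<inter> X"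
    unfolding nonbranch_X_def ev coords_wproj using X_points by blast
  have open_W: "openin (subtopology (zariski ?S) X) nonbranch_X"
    unfolding openin_subtopology using op eq by blast
  have "subtopology (zariski ?S) X closure_of nonbranch_X = topspace (subtopology (zariski ?S) X)"
    unfolding dense_intersects_open
  proof (intro allI impI, elim conjE)
    fix T assume "openin (subtopology (zariski ?S) X) T" "T \<noteq> {}"
    then obtain N R where N: "openin (zariski ?S) N" "T = N \<inter> X" "R \<in> N" "R \<in> X"
      by (auto simp: openin_subtopology)
    have "R \<in> points ?S" using N X_points by blast
    then obtain z where z: "R = wpoint tw z" by (auto simp: points_wproj)
    have "z \<in> coords ?S R" unfolding z by simp
    from zariski_open_classical_nhd[OF homogeneous_coords_wproj N(1) N(3) this]
    obtain A where A: "open A" "z \<in> A"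
      and AN: "\<And>Q y. Q \<in> points ?S \<Longrightarrow> y \<in> coords ?S Q \<Longrightarrow> y \<in> A \<Longrightarrow> Q \<in> N" by blast
    have "peval p (\<lambda>i. z (Inl i)) = peval q (\<lambda>j. z (Inr j))"
      using N(4) unfolding z difference_hypersurface_iff[OF p q] by blast
    then obtain z' where z': "z' \<in> A" "peval p (\<lambda>i. z' (Inl i)) = peval q (\<lambda>j. z' (Inr j))"
      "peval p (\<lambda>i. z' (Inl i)) \<noteq> 0"
      using difference_cone_perturb[OF _ _ _ A] p_nonzero q_nonzero by metis
    have W: "wpoint tw z' \<in> nonbranch_X" unfolding nonbranch_X_iff using z' by blast
    then have "wpoint tw z' \<in> points ?S" "wpoint tw z' \<in> X"
      using X_points by (auto simp: nonbranch_X_def)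
    then have "wpoint tw z' \<in> T" using AN[OF _ _ z'(1)] N(2) by simp
    with W show "nonbranch_X \<inter> T \<noteq> {}" by blast
  qed
  with open_W show ?thesis by (simp add: dense_open_def)
qed

lemma closure_of_image:
  "subtopology (zariski (wproj tw)) X closure_of (\<Union>P\<in>U. twist_map w v P) = X"
proof -
  have top: "topspace (subtopology (zariski (wproj tw)) X) = X"
    using X_points by auto
  have "nonbranch_X \<subseteq> (\<Union>P\<in>U. twist_map w v P)" using nonbranch_X_subset_image by blast
  from closure_of_mono[OF this, of "subtopology (zariski (wproj tw)) X"]
  have "X \<subseteq> subtopology (zariski (wproj tw)) X closure_of (\<Union>P\<in>U. twist_map w v P)"
    using dense_open_nonbranch_X top unfolding dense_open_def by simp
  moreover have "subtopology (zariski (wproj tw)) X closure_of (\<Union>P\<in>U. twist_map w v P) \<subseteq> X"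
    using closure_of_subset_topspace[of "subtopology (zariski (wproj tw)) X"] unfolding top by blast
  ultimately show ?thesis by blast
qed

section \<open>The twist map as a morphism\<close>

lemma root_twist_value:
  assumes PQ: "(P, Q) \<in> U" and P': "P' \<in> root_points (v None) w P"
    and Q': "Q' \<in> root_points (w None) v Q" and z: "z \<in> P'" "z' \<in> Q'"
  shows "root_twist w v (P', Q') = wpoint tw (twist_vec w v z z' (z' None) (z None))"
    and "wpoint tw (twist_vec w v z z' (z' None) (z None)) \<in> twist_map w v (P, Q)"
    and "root_twist w v (P', Q') \<in> X"
proof -
  have pts: "P \<in> points (wproj w)" "Q \<in> points (wproj v)" "P \<in> V1" "Q \<in> V2"
    using PQ V1_points V2_points by (auto simp: nonbranch_def)
  note E1 = root_pointsD[OF P' z(1)] and E2 = root_pointsD[OF Q' z(2)]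
  show eq: "root_twist w v (P', Q') = wpoint tw (twist_vec w v z z' (z' None) (z None))"
    unfolding E1(1) E2(1) by (rule root_twist_eq)
  define x where "x = z(None := z None ^ v None)"
  define y where "y = z'(None := z' None ^ w None)"
  have xy: "x \<in> P" "y \<in> Q" using E1 E2 by (auto simp: x_def y_def)
  have roots: "z' None ^ w None = y None" "z None ^ v None = x None" by (simp_all add: x_def y_def)
  have P: "P = wpoint w x" "Q = wpoint v y"
    using point_eq_wpoint(1) pts xy by blast+
  have V: "wpoint w x \<in> V1" "wpoint v y \<in> V2" using pts P by simp_all
  have nz: "x None \<noteq> 0" "y None \<noteq> 0" using PQ xy by (auto simp: nonbranch_def)
  have tv: "twist_vec w v x y (z' None) (z None) = twist_vec w v z z' (z' None) (z None)"
    by (simp add: x_def y_def)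
  note val = twist_value_in_X[OF V nz roots]
  show "wpoint tw (twist_vec w v z z' (z' None) (z None)) \<in> twist_map w v (P, Q)"
    using in_twist_mapI[where w = w and v = v, OF xy roots val(1)] unfolding tv .
  show "root_twist w v (P', Q') \<in> X" using val(2) unfolding eq tv .
qed

lemma root_twist_image:
  assumes PQ: "(P, Q) \<in> U"
  shows "twist_map w v (P, Q) =
    root_twist w v ` (root_points (v None) w P \<times> root_points (w None) v Q)"
proof (intro equalityI subsetI)
  have pts: "P \<in> points (wproj w)" "Q \<in> points (wproj v)"
    using PQ V1_points V2_points by (auto simp: nonbranch_def)
  fix R assume "R \<in> twist_map w v (P, Q)"
  then obtain x y s r where xy: "x \<in> P" "y \<in> Q" "s ^ w None = y None" "r ^ v None = x None"
    and R: "R = wpoint tw (twist_vec w v x y s r)"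
    unfolding in_twist_map_iff by blast
  define P' where "P' = wpoint (root_weights (v None) w) (x(None := r))"
  define Q' where "Q' = wpoint (root_weights (w None) v) (y(None := s))"
  have "P' \<in> root_points (v None) w P"
    unfolding P'_def root_points_iff[OF v_pos pts(1)] using xy by simp
  moreover have "Q' \<in> root_points (w None) v Q"
    unfolding Q'_def root_points_iff[OF w_pos pts(2)] using xy by simp
  moreover have "R = root_twist w v (P', Q')"
    unfolding P'_def Q'_def root_twist_eq R by simp
  ultimately show "R \<in> root_twist w v ` (root_points (v None) w P \<times> root_points (w None) v Q)"
    by blast
next
  fix R assume "R \<in> root_twist w v ` (root_points (v None) w P \<times> root_points (w None) v Q)"
  then obtain P' Q' where P': "P' \<in> root_points (v None) w P" and Q': "Q' \<in> root_points (w None) v Q"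
    and R: "R = root_twist w v (P', Q')" by auto
  then obtain z z' where "z \<in> P'" "z' \<in> Q'"
    by (auto simp: root_points_def points_wproj) (metis wpoint_self)
  from root_twist_value(1,2)[OF PQ P' Q' this] show "R \<in> twist_map w v (P, Q)"
    unfolding R by simp
qed

lemma twist_rational_in_roots_U: "twist_rational_in_roots w v U X"
proof -
  let ?S = "wproj_prod (root_weights (v None) w) (root_weights (w None) v)"
  let ?U = "\<Union>(P, Q)\<in>U. root_points (v None) w P \<times> root_points (w None) v Q"
  have sub: "?U \<subseteq> points ?S" by (auto simp: root_points_def)
  have ne: "P' \<noteq> {}" if "P' \<in> points (wproj u)" for P' :: "'i::finite wpoint" and u
    using that by (auto simp: points_wproj) (metis wpoint_self empty_iff)
  have "morphism ?S ?U (wproj tw) X (root_twist w v)"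
  proof (rule morphismI)
    show "homogeneous_coords (wproj tw)" by (rule homogeneous_coords_wproj)
    show "coords ?S PQ \<noteq> {}" if "PQ \<in> ?U" for PQ
    proof -
      obtain P' Q' where PQ: "PQ = (P', Q')" by (cases PQ)
      with that sub have "P' \<noteq> {}" "Q' \<noteq> {}" using ne by auto
      then show ?thesis unfolding PQ coords_wproj_prod by blast
    qed
    show "root_twist w v ` ?U \<subseteq> X"
    proof
      fix R assume "R \<in> root_twist w v ` ?U"
      then obtain P Q P' Q' where PQ: "(P, Q) \<in> U" and P': "P' \<in> root_points (v None) w P"
        and Q': "Q' \<in> root_points (w None) v Q" and R: "R = root_twist w v (P', Q')" by auto
      have "R \<in> twist_map w v (P, Q)" unfolding R root_twist_image[OF PQ] using P' Q' by blast
      then show "R \<in> X" using twist_map_U(3)[OF PQ] by blast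
    qed
    fix d
    show "\<exists>e F. (\<forall>g. homog (wproj tw) d g \<longrightarrow> homog ?S e (F g)) \<and>
      (\<forall>P\<in>?U. \<forall>x\<in>coords ?S P. \<exists>z\<in>coords (wproj tw) (root_twist w v P). \<exists>c. c \<noteq> 0 \<and>
         (\<forall>g. homog (wproj tw) d g \<longrightarrow> peval g z = c * peval (F g) x))"
    proof (rule exI[of _ "(d, d)"], rule exI[of _ "root_pullback w v"], intro conjI ballI allI impI)
      fix g assume "homog (wproj tw) d g"
      then show "homog ?S (d, d) (root_pullback w v g)"
        by (intro homog_root_pullback) simp
    next
      fix PQ z0 assume "PQ \<in> ?U" "z0 \<in> coords ?S PQ"
      then obtain P Q P' Q' x y where PQ: "(P, Q) \<in> U" and P': "P' \<in> root_points (v None) w P"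
        and Q': "Q' \<in> root_points (w None) v Q" and eq: "PQ = (P', Q')"
        and z0: "z0 = case_sum x y" and xy: "x \<in> P'" "y \<in> Q'" by auto
      show "\<exists>z\<in>coords (wproj tw) (root_twist w v PQ). \<exists>c. c \<noteq> 0 \<and>
         (\<forall>g. homog (wproj tw) d g \<longrightarrow> peval g z = c * peval (root_pullback w v g) z0)"
        unfolding eq z0 root_twist_value(1)[OF PQ P' Q' xy] coords_wproj peval_root_pullback
        by (rule bexI[OF _ wpoint_self], rule exI[of _ 1]) simp
    qed
  qed (use sub X_points in auto)
  moreover have "\<forall>(P, Q)\<in>U. twist_map w v (P, Q) =
      root_twist w v ` (root_points (v None) w P \<times> root_points (w None) v Q)"
    using root_twist_image by blast
  ultimately show ?thesis unfolding twist_rational_in_roots_def by blast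
qed

lemma twist_map_singleton:
  assumes cop: "coprime (w None) (v None)" and PQ: "(P, Q) \<in> U" and xy: "x \<in> P" "y \<in> Q"
    and roots: "s ^ w None = y None" "r ^ v None = x None"
  shows "twist_map w v (P, Q) = {wpoint tw (twist_vec w v x y s r)}"
proof -
  have pts: "P \<in> points (wproj w)" "Q \<in> points (wproj v)" "P \<in> V1" "Q \<in> V2"
    using PQ V1_points V2_points by (auto simp: nonbranch_def)
  have P: "P = wpoint w x" "Q = wpoint v y"
    using point_eq_wpoint(1) pts xy by blast+
  have nz: "x None \<noteq> 0" "y None \<noteq> 0" using PQ xy by (auto simp: nonbranch_def)
  have sr: "s \<noteq> 0" "r \<noteq> 0" using nz roots w_pos v_pos by (auto simp: zero_power)
  have "R = wpoint tw (twist_vec w v x y s r)" if R: "R \<in> twist_map w v (P, Q)" for R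
  proof -
    obtain s' r' where r': "s' ^ w None = y None" "r' ^ v None = x None"
      and R': "R = wpoint tw (twist_vec w v x y s' r')"
      by (rule twist_map_fixed_coords[where w = w and v = v, OF w_pos v_pos R[unfolded P]])
    have "s ^ w None = s' ^ w None" "r ^ v None = r' ^ v None" using r' roots by simp_all
    from twist_vec_roots_coprime[where w = w and v = v, OF cop this sr w_pos v_pos]
    show ?thesis unfolding R' .
  qed
  with twist_map_U(1)[OF PQ] show ?thesis by blast
qed

text \<open>
  By \<open>twist_map_singleton\<close> the map may be computed from any coordinates and any roots, so at each
  pair of coordinate vectors \<open>coprime_pullback\<close> applies to whichever roots are chosen there.
\<close>

lemma coprime_morphism:
  assumes cop: "coprime (w None) (v None)"
  shows "\<exists>\<phi>. morphism (wproj_prod w v) U (wproj tw) X \<phi> \<and> (\<forall>P\<in>U. twist_map w v P = {\<phi> P})"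
proof -
  let ?S = "wproj_prod w v"
  define \<phi> where "\<phi> = (\<lambda>PQ. the_elem (twist_map w v PQ))"
  have sub: "U \<subseteq> points ?S" using V1_points V2_points by (auto simp: nonbranch_def)
  have single: "twist_map w v (P, Q) = {\<phi> (P, Q)}"
    "\<phi> (P, Q) = wpoint tw (twist_vec w v x y s r)"
    if "(P, Q) \<in> U" "x \<in> P" "y \<in> Q" "s ^ w None = y None" "r ^ v None = x None" for P Q x y s r
    using twist_map_singleton[OF cop that] by (simp_all add: \<phi>_def)
  have all_single: "twist_map w v PQ = {\<phi> PQ}" if PQ: "PQ \<in> U" for PQ
  proof -
    obtain P Q where eq: "PQ = (P, Q)" by (cases PQ)
    obtain x y where "P = wpoint w x" "Q = wpoint v y"
      by (rule nonbranchE[OF PQ[unfolded eq] V1_points V2_points])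
    then have "x \<in> P" "y \<in> Q" by simp_all
    moreover obtain s r where "s ^ w None = y None" "r ^ v None = x None"
      using complex_root_exists w_pos v_pos by metis
    ultimately show ?thesis using single(1) PQ unfolding eq by blast
  qed
  have "morphism ?S U (wproj tw) X \<phi>"
  proof (rule morphismI)
    show "homogeneous_coords (wproj tw)" by (rule homogeneous_coords_wproj)
    show "coords ?S PQ \<noteq> {}" if PQ: "PQ \<in> U" for PQ
    proof -
      obtain P Q where eq: "PQ = (P, Q)" by (cases PQ)
      obtain x y where "P = wpoint w x" "Q = wpoint v y"
        by (rule nonbranchE[OF PQ[unfolded eq] V1_points V2_points])
      then have "x \<in> P" "y \<in> Q" by simp_all
      then show ?thesis unfolding eq coords_wproj_prod by blast
    qed
    show "\<phi> ` U \<subseteq> X" using all_single twist_map_U(3) by blast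
    fix d
    obtain A B where hom: "\<And>g. whomog tw d g \<Longrightarrow>
        homog ?S (w None * d + A, B) (coprime_pullback w d g)"
      and ev: "\<And>g x y s r. whomog tw d g \<Longrightarrow> s ^ w None = y None \<Longrightarrow> r ^ v None = x None \<Longrightarrow>
        x None ^ d * peval g (twist_vec w v x y s r) =
          s ^ A * r ^ B * peval (coprime_pullback w d g) (case_sum x y)"
      using coprime_pullback[where w = w and v = v and d = d, OF cop w_pos v_pos] by blast
    show "\<exists>e F. (\<forall>g. homog (wproj tw) d g \<longrightarrow> homog ?S e (F g)) \<and>
      (\<forall>P\<in>U. \<forall>x\<in>coords ?S P. \<exists>z\<in>coords (wproj tw) (\<phi> P). \<exists>c. c \<noteq> 0 \<and>
         (\<forall>g. homog (wproj tw) d g \<longrightarrow> peval g z = c * peval (F g) x))"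
    proof (rule exI[of _ "(w None * d + A, B)"], rule exI[of _ "coprime_pullback w d"],
        intro conjI ballI allI impI)
      fix g assume "homog (wproj tw) d g"
      then show "homog ?S (w None * d + A, B) (coprime_pullback w d g)"
        by (intro hom) simp
    next
      fix PQ z0 assume "PQ \<in> U" "z0 \<in> coords ?S PQ"
      then obtain P Q x y where PQ: "(P, Q) \<in> U" and eq: "PQ = (P, Q)"
        and z0: "z0 = case_sum x y" and xy: "x \<in> P" "y \<in> Q" by (cases PQ) auto
      obtain s r where roots: "s ^ w None = y None" "r ^ v None = x None"
        using complex_root_exists w_pos v_pos by metis
      have nz: "x None \<noteq> 0" "y None \<noteq> 0" using PQ xy by (auto simp: nonbranch_def)
      have sr: "s \<noteq> 0" "r \<noteq> 0" using nz roots w_pos v_pos by (auto simp: zero_power)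
      have "peval g (twist_vec w v x y s r) =
          s ^ A * r ^ B / x None ^ d * peval (coprime_pullback w d g) (case_sum x y)"
        if "homog (wproj tw) d g" for g
        using ev[where x = x and y = y, OF _ roots, of g] that nz by (simp add: field_simps)
      moreover have "s ^ A * r ^ B / x None ^ d \<noteq> 0" using sr nz by simp
      ultimately show "\<exists>z\<in>coords (wproj tw) (\<phi> PQ). \<exists>c. c \<noteq> 0 \<and>
         (\<forall>g. homog (wproj tw) d g \<longrightarrow> peval g z = c * peval (coprime_pullback w d g) z0)"
        unfolding eq z0 single(2)[OF PQ xy roots] coords_wproj
        by (intro bexI[OF _ wpoint_self] exI[of _ "s ^ A * r ^ B / x None ^ d"] conjI allI impI)
    qed
  qed (use sub X_points in auto)
  with all_single show ?thesis by blast
qed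

end

section \<open>Generic finiteness of the twist map\<close>

theorem lemma3p1:
  fixes w :: "'n::finite option \<Rightarrow> nat" and v :: "'m::finite option \<Rightarrow> nat"
    and l :: nat and p :: "'n cpoly" and q :: "'m cpoly"
    and V1 :: "'n option wpoint set" and V2 :: "'m option wpoint set"
    and X :: "('n + 'm) wpoint set"
    and Y_top :: "('n option wpoint \<times> 'm option wpoint) topology"
    and X_top :: "('n + 'm) wpoint topology"
  assumes "\<And>i. w i > 0" and "\<And>j. v j > 0"
    and "normalized_weights w" and "normalized_weights v"
    and "l \<ge> 1"
    and "whomog (\<lambda>i. w (Some i)) (l * w None) p" and "quasi_smooth p"
    and "whomog (\<lambda>j. v (Some j)) (l * v None) q" and "quasi_smooth q"
    and "V1 = cyclic_hypersurface w l p"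
    and "V2 = cyclic_hypersurface v l q"
    and "X = difference_hypersurface (twist_weights w v) p q"
    and "Y_top = subtopology (zariski (wproj_prod w v)) (V1 \<times> V2)"
    and "X_top = subtopology (zariski (wproj (twist_weights w v))) X"
  shows "\<exists>U. dense_open Y_top U \<and>
    (\<forall>P\<in>U. twist_map w v P \<noteq> {} \<and> finite (twist_map w v P) \<and> twist_map w v P \<subseteq> X) \<and>
    twist_rational_in_roots w v U X \<and>
    (coprime (w None) (v None) \<longrightarrow>
      (\<exists>\<phi>. morphism (wproj_prod w v) U (wproj (twist_weights w v)) X \<phi> \<and>
           (\<forall>P\<in>U. twist_map w v P = {\<phi> P}))) \<and>
    X_top closure_of (\<Union>P\<in>U. twist_map w v P) = X \<and>
    (\<exists>W. dense_open X_top W \<and>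
      (\<forall>R\<in>W. finite {P \<in> V1 \<times> V2. R \<in> twist_map w v P}))"
proof -
  obtain zp where "peval p zp \<noteq> 0" using quasi_smooth_nonzero[OF assms(7)] .
  moreover obtain zq where "peval q zq \<noteq> 0" using quasi_smooth_nonzero[OF assms(9)] .
  ultimately interpret cyclic_pair w v l p q
    using assms(1,2,5,6,8) by unfold_locales auto
  show ?thesis
    unfolding assms(10-14)
    using dense_open_U twist_map_U twist_rational_in_roots_U coprime_morphism closure_of_image
      dense_open_nonbranch_X finite_fibre
    by (intro exI[of _ U] conjI ballI impI exI[of _ nonbranch_X])
qed

end
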